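(* Let $(u_h,\rho_h,p_h)$, with $u_h(t)\in U_h$, $\rho_h(t)\in F_h$, $p_h(t)\in Q_h$ for $t\in(0,T)$, be a solution of the semidiscrete scheme: for every $t$, $$\sum_{e \in \mathcal{E}_h} \int_e \Big( \alpha_e(u_h) (n \times \llbracket \rho_h u_h \rrbracket ) \cdot \llbracket u_h \times v_h \rrbracket + \frac{\beta_e(u_h)}{2|u_h \cdot n|^2} (u_h \cdot n)(v_h \cdot n) \llbracket \overline{u_h \cdot u_h} \rrbracket \cdot \llbracket \rho_h\rrbracket \Big) ds + \langle \partial_t (\rho_h u_h), v_h \rangle + a_h(\rho_h u_h, u_h, v_h) - \frac{1}{2} b_h(v_h, \overline{u_h \cdot u_h}, \rho_h) - \langle p_h, \operatorname{div} v_h \rangle = 0 \quad \forall v_h \in U_h,$$ $$\langle \partial_t \rho_h, \sigma_h \rangle - b_h(u_h, \sigma_h, \rho_h) + \sum_{e \in \mathcal{E}_h} \int_e \beta_e(u_h) \llbracket \sigma_h \rrbracket \cdot \llbracket \rho_h \rrbracket \, ds = 0 \quad \forall \sigma_h \in F_h,$$ $$\langle \operatorname{div} u_h, q_h \rangle = 0 \quad \forall q_h \in Q_h.$$ Then, for every $t$, $\operatorname{div} u_h(t) \equiv 0$ on $\Omega$.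
   Context: Let $n\in\{2,3\}$ be the dimension and $\Omega\subset\mathbb{R}^n$ a bounded domain with a triangulation $\mathcal{T}_h$ into simplices; $\mathcal{E}_h$ is the set of interior $(n-1)$-dimensional faces. (The symbol $n$ also denotes unit normal vectors.) $P_r(K)$ is the space of polynomials of degree at most $r$ on $K$. Let $H_0(\operatorname{div},\Omega)=\{u\in L^2(\Omega)^n \mid \operatorname{div}u\in L^2(\Omega),\ u\cdot n=0 \text{ on }\partial\Omega\}$. Fix integers $s,m\ge 0$ and set: - $RT_s(\mathcal{T}_h)=\{u\in H_0(\operatorname{div},\Omega)\mid u|_K\in P_s(K)^n+xP_s(K)\ \forall K\in\mathcal{T}_h\}$; - $BDM_{s+1}(\mathcal{T}_h)=\{u\in H_0(\operatorname{div},\Omega)\mid u|_K\in P_{s+1}(K)^n\ \forall K\in\mathcal{T}_h\}$; - $DG_r(\mathcal{T}_h)=\{f\in L^2(\Omega)\mid f|_K\in P_r(K)\ \forall K\in\mathcal{T}_h\}$; - $U_h\in\{RT_s(\mathcal{T}_h),BDM_{s+1}(\mathcal{T}_h)\}$, $F_h=DG_m(\mathcal{T}_h)$, $Q_h=DG_s(\mathcal{T}_h)$. $W_h$ is the space of vector fields on $\Omega$ that are piecewise smooth with respect to $\mathcal{T}_h$. $\langle\cdot,\cdot\rangle$ is the $L^2(\Omega)$ inner product (of scalar or vector fields). $\overline{f}\in F_h$ denotes the $L^2$-orthogonal projection of $f$ onto $F_h$. Jumps and averages on $e=K_1\cap K_2\in\mathcal{E}_h$: for scalar $f$ with $f_i=f|_{K_i}$,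 $\llbracket f\rrbracket=f_1n_1+f_2n_2$ and $\{f\}=\frac{f_1+f_2}{2}$, where $n_1$ is the unit normal to $e$ pointing from $K_1$ to $K_2$ and $n_2=-n_1$. For vector fields, fix a unit normal $n$ for each $e$, order $K_1,K_2$ so that $n$ points from $K_1$ to $K_2$, and set $\llbracket u\rrbracket=u_1-u_2$, $\{u\}=\frac{u_1+u_2}{2}$; the jump $\llbracket u\times v\rrbracket$ is the difference $u_1\times v_1-u_2\times v_2$. In dimension 2, vectors are embedded in $\mathbb{R}^3$ with zero third component to form cross products. For $u\in U_h$, $u\cdot n$ is single-valued on $e$. Trilinear forms $a_h:W_h\times U_h\times U_h\to\mathbb{R}$ and $b_h:U_h\times F_h\times F_h\to\mathbb{R}$: $$a_h(w,u,v)=\sum_{K\in\mathcal{T}_h}\int_K w\cdot(v\cdot\nabla u-u\cdot\nabla v)\,dx+\sum_{e\in\mathcal{E}_h}\int_e(n\times\{w\})\cdot\llbracket u\times v\rrbracket\,ds,$$ $$b_h(u,f,g)=\sum_{K\in\mathcal{T}_h}\int_K(u\cdot\nabla f)g\,dx-\sum_{e\in\mathcal{E}_h}\int_e u\cdot\llbracket f\rrbracket\{g\}\,ds.$$ Parameters: for each $e\in\mathcal{E}_h$, $\alpha_e(u_h)$ and $\beta_e(u_h)$ are functions on $e$ that may depend on $u_h$, such that the integrals in the scheme are well defined. $\beta_e(u_h)\ge 0$; $\alpha_e(u_h)$ is either nonnegative or of the form $c_1\frac{u_h\cdot n}{|u_h\cdot n|}$ with $c_1\in[0,\frac12]$ (taken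 to be $0$ where $u_h\cdot n=0$). Where $u_h\cdot n=0$, $\beta_e(u_h)$ is assumed to vanish (as for the standard choice $\beta_e(u_h)=c_2|u_h\cdot n|$, $c_2\in[0,\frac12]$), and the coefficient $\frac{\beta_e(u_h)}{2|u_h\cdot n|^2}(u_h\cdot n)(v_h\cdot n)$ is taken to be $0$ there. The solution is assumed differentiable in time. *)

theory Defs
  imports "HOL-Analysis.Analysis"
begin

subsection \<open>Differential operators and Sobolev-type spaces\<close>

definition grad :: "(real^'n \<Rightarrow> real) \<Rightarrow> real^'n \<Rightarrow> real^'n" where
  "grad f x = (\<chi> i. frechet_derivative f (at x) (axis i 1))"

primrec Ck_on :: "nat \<Rightarrow> (real^'n) set \<Rightarrow> (real^'n \<Rightarrow> real) \<Rightarrow> bool" where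
  "Ck_on 0 S f \<longleftrightarrow> continuous_on S f"
| "Ck_on (Suc k) S f \<longleftrightarrow>
     (\<forall>x\<in>S. f differentiable (at x)) \<and> (\<forall>i. Ck_on k S (\<lambda>x. grad f x $ i))"

definition smooth_on :: "(real^'n) set \<Rightarrow> (real^'n \<Rightarrow> real) \<Rightarrow> bool" where
  "smooth_on S f \<longleftrightarrow> (\<forall>k. Ck_on k S f)"

definition test_functions :: "(real^'n) set \<Rightarrow> (real^'n \<Rightarrow> real) set" where
  "test_functions \<Omega> =
     {\<phi>. smooth_on UNIV \<phi> \<and> compact (closure {x. \<phi> x \<noteq> 0}) \<and> closure {x. \<phi> x \<noteq> 0} \<subseteq> \<Omega>}"

definition L2 :: "(real^'n) set \<Rightarrow> (real^'n \<Rightarrow> 'b::euclidean_space) set" where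
  "L2 \<Omega> = {f. f \<in> borel_measurable (lebesgue_on \<Omega>) \<and>
               integrable (lebesgue_on \<Omega>) (\<lambda>x. (norm (f x))\<^sup>2)}"

definition L2_inner ::
  "(real^'n) set \<Rightarrow> (real^'n \<Rightarrow> 'b::euclidean_space) \<Rightarrow> (real^'n \<Rightarrow> 'b) \<Rightarrow> real" where
  "L2_inner \<Omega> f g = (LINT x:\<Omega>|lebesgue. f x \<bullet> g x)"

definition has_weak_div :: "(real^'n) set \<Rightarrow> (real^'n \<Rightarrow> real^'n) \<Rightarrow> (real^'n \<Rightarrow> real) \<Rightarrow> bool" where
  "has_weak_div \<Omega> u d \<longleftrightarrow>
     d \<in> L2 \<Omega> \<and> (\<forall>\<phi>\<in>test_functions \<Omega>. L2_inner \<Omega> u (grad \<phi>) = - L2_inner \<Omega> d \<phi>)"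

text \<open>The weak divergence is determined only up to null sets; any representative may be taken.\<close>

definition weak_div :: "(real^'n) set \<Rightarrow> (real^'n \<Rightarrow> real^'n) \<Rightarrow> real^'n \<Rightarrow> real" where
  "weak_div \<Omega> u = (SOME d. has_weak_div \<Omega> u d)"

text \<open>
  The condition \<open>u \<cdot> n = 0\<close> on the boundary is the vanishing of the normal trace
  \<open>\<phi> \<mapsto> \<integral> u \<cdot> grad \<phi> + (div u) \<phi>\<close> on \<open>H\<^sup>1(\<Omega>)\<close>. It is tested on
  the smooth functions in \<open>H\<^sup>1(\<Omega>)\<close>, which are dense for every open \<open>\<Omega>\<close>
  (Meyers-Serrin).
\<close>

definition H0div :: "(real^'n) set \<Rightarrow> (real^'n \<Rightarrow> real^'n) set" where
  "H0div \<Omega> = {u. u \<in> L2 \<Omega> \<and> (\<exists>d. has_weak_div \<Omega> u d) \<and>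
     (\<forall>\<phi>. smooth_on \<Omega> \<phi> \<and> \<phi> \<in> L2 \<Omega> \<and> grad \<phi> \<in> L2 \<Omega> \<longrightarrow>
        L2_inner \<Omega> u (grad \<phi>) + L2_inner \<Omega> (weak_div \<Omega> u) \<phi> = 0)}"

subsection \<open>Triangulations and interior faces\<close>

definition triangulates :: "(real^'n) set set \<Rightarrow> (real^'n) set \<Rightarrow> bool" where
  "triangulates Th \<Omega> \<longleftrightarrow>
     triangulation Th \<and> (\<forall>K\<in>Th. int CARD('n) simplex K) \<and> \<Union>Th = closure \<Omega>"

text \<open>
  The condition on the relative interior only matters if \<open>\<Omega>\<close> lies on both sides of part
  of its boundary (a slit): such faces are boundary faces.
\<close>

definition interior_faces :: "(real^'n) set set \<Rightarrow> (real^'n) set \<Rightarrow> (real^'n) set set" where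
  "interior_faces Th \<Omega> =
     {K1 \<inter> K2 | K1 K2. K1 \<in> Th \<and> K2 \<in> Th \<and> aff_dim (K1 \<inter> K2) = int CARD('n) - 1 \<and>
                        rel_interior (K1 \<inter> K2) \<subseteq> \<Omega>}"

definition unit_normal :: "(real^'n) set \<Rightarrow> real^'n \<Rightarrow> bool" where
  "unit_normal e \<nu> \<longleftrightarrow> norm \<nu> = 1 \<and> (\<forall>x\<in>e. \<forall>y\<in>e. \<nu> \<bullet> (x - y) = 0)"

text \<open>
  The element adjacent to \<open>e\<close> from which the unit normal \<open>\<nu>\<close> points outwards. With \<open>n\<close> the
  chosen normal of \<open>e\<close>, the neighbours are \<open>K1 = cell_behind Th e n\<close> and
  \<open>K2 = cell_behind Th e (- n)\<close>, so that \<open>n\<close> points from \<open>K1\<close> to \<open>K2\<close>.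
\<close>

definition cell_behind :: "(real^'n) set set \<Rightarrow> (real^'n) set \<Rightarrow> real^'n \<Rightarrow> (real^'n) set" where
  "cell_behind Th e \<nu> = (THE K. K \<in> Th \<and> e \<subseteq> K \<and> (\<forall>x\<in>K. \<forall>y\<in>e. \<nu> \<bullet> (x - y) \<le> 0))"

subsection \<open>Finite element spaces\<close>

definition poly_space :: "nat \<Rightarrow> (real^'n \<Rightarrow> real) set" where
  "poly_space r =
     {p. \<exists>c :: ('n \<Rightarrow> nat) \<Rightarrow> real.
           p = (\<lambda>x. \<Sum>a | (\<Sum>i\<in>UNIV. a i) \<le> r. c a * (\<Prod>i\<in>UNIV. x $ i ^ a i))}"

definition vec_poly_space :: "nat \<Rightarrow> (real^'n \<Rightarrow> real^'n) set" where
  "vec_poly_space r = {p. \<forall>i. (\<lambda>x. p x $ i) \<in> poly_space r}"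

text \<open>
  Elements of the broken spaces are represented by functions that agree with a polynomial on
  the interior of every element; their values on the (null) set of faces are arbitrary.
\<close>

definition DG :: "(real^'n) set \<Rightarrow> (real^'n) set set \<Rightarrow> nat \<Rightarrow> (real^'n \<Rightarrow> real) set" where
  "DG \<Omega> Th r = {f. f \<in> L2 \<Omega> \<and> (\<forall>K\<in>Th. \<exists>p\<in>poly_space r. \<forall>x\<in>interior K. f x = p x)}"

definition RT :: "(real^'n) set \<Rightarrow> (real^'n) set set \<Rightarrow> nat \<Rightarrow> (real^'n \<Rightarrow> real^'n) set" where
  "RT \<Omega> Th s = {u. u \<in> H0div \<Omega> \<and>
     (\<forall>K\<in>Th. \<exists>p\<in>vec_poly_space s. \<exists>q\<in>poly_space s. \<forall>x\<in>interior K. u x = p x + q x *\<^sub>R x)}"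

definition BDM :: "(real^'n) set \<Rightarrow> (real^'n) set set \<Rightarrow> nat \<Rightarrow> (real^'n \<Rightarrow> real^'n) set" where
  "BDM \<Omega> Th r = {u. u \<in> H0div \<Omega> \<and> (\<forall>K\<in>Th. \<exists>p\<in>vec_poly_space r. \<forall>x\<in>interior K. u x = p x)}"

text \<open>The \<open>L\<^sup>2\<close>-orthogonal projection, unique up to values on the faces.\<close>

definition L2_proj ::
  "(real^'n) set \<Rightarrow> (real^'n \<Rightarrow> real) set \<Rightarrow> (real^'n \<Rightarrow> real) \<Rightarrow> real^'n \<Rightarrow> real" where
  "L2_proj \<Omega> F f = (SOME g. g \<in> F \<and> (\<forall>\<sigma>\<in>F. L2_inner \<Omega> (\<lambda>x. f x - g x) \<sigma> = 0))"

subsection \<open>Integrals over faces, jumps and averages\<close>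

text \<open>
  Surface measure of a flat face \<open>e\<close> with unit normal \<open>\<nu>\<close>: by Fubini, the surface integral of
  \<open>g\<close> over \<open>e\<close> is the volume integral over the prism \<open>e + [0,1] \<nu>\<close> of \<open>g\<close> composed with the
  orthogonal projection onto the hyperplane spanned by \<open>e\<close>.
\<close>

definition prism :: "(real^'n) set \<Rightarrow> real^'n \<Rightarrow> (real^'n) set" where
  "prism e \<nu> = {y + r *\<^sub>R \<nu> | y r. y \<in> e \<and> 0 \<le> r \<and> r \<le> 1}"

definition face_integrable ::
  "(real^'n) set \<Rightarrow> real^'n \<Rightarrow> (real^'n \<Rightarrow> real) \<Rightarrow> bool" where
  "face_integrable e \<nu> g \<longleftrightarrow>
     set_integrable lebesgue (prism e \<nu>) (\<lambda>x. g (closest_point (affine hull e) x))"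

definition face_integral ::
  "(real^'n) set \<Rightarrow> real^'n \<Rightarrow> (real^'n \<Rightarrow> real) \<Rightarrow> real" where
  "face_integral e \<nu> g =
     (LINT x:prism e \<nu>|lebesgue. g (closest_point (affine hull e) x))"

definition elem_trace :: "(real^'n) set \<Rightarrow> (real^'n \<Rightarrow> 'b::t2_space) \<Rightarrow> real^'n \<Rightarrow> 'b" where
  "elem_trace K f x = Lim (at x within interior K) f"

definition avg ::
  "(real^'n) set set \<Rightarrow> (real^'n) set \<Rightarrow> real^'n \<Rightarrow> (real^'n \<Rightarrow> 'b::real_normed_vector) \<Rightarrow> real^'n \<Rightarrow> 'b" where
  "avg Th e n f x =
     (1/2) *\<^sub>R (elem_trace (cell_behind Th e n) f x + elem_trace (cell_behind Th e (- n)) f x)"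

definition scalar_jump ::
  "(real^'n) set set \<Rightarrow> (real^'n) set \<Rightarrow> real^'n \<Rightarrow> (real^'n \<Rightarrow> real) \<Rightarrow> real^'n \<Rightarrow> real^'n" where
  "scalar_jump Th e n f x =
     elem_trace (cell_behind Th e n) f x *\<^sub>R n + elem_trace (cell_behind Th e (- n)) f x *\<^sub>R (- n)"

definition vec_jump ::
  "(real^'n) set set \<Rightarrow> (real^'n) set \<Rightarrow> real^'n \<Rightarrow> (real^'n \<Rightarrow> real^'n) \<Rightarrow> real^'n \<Rightarrow> real^'n" where
  "vec_jump Th e n u x =
     elem_trace (cell_behind Th e n) u x - elem_trace (cell_behind Th e (- n)) u x"

text \<open>
  \<open>u \<cdot> n\<close> on a face. It is single-valued for \<open>u\<close> in the finite element spaces, where the average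
  coincides with both one-sided traces.
\<close>

definition normal_comp ::
  "(real^'n) set set \<Rightarrow> (real^'n) set \<Rightarrow> real^'n \<Rightarrow> (real^'n \<Rightarrow> real^'n) \<Rightarrow> real^'n \<Rightarrow> real" where
  "normal_comp Th e n u x = avg Th e n u x \<bullet> n"

text \<open>
  Embedding into \<open>\<real>\<^sup>3\<close> along a numbering \<open>\<iota>\<close> of the coordinates; coordinates outside the
  range of \<open>\<iota>\<close> are zero.
\<close>

definition embed3 :: "('n \<Rightarrow> 3) \<Rightarrow> real^'n \<Rightarrow> real^3" where
  "embed3 \<iota> v = (\<chi> k. \<Sum>i | \<iota> i = k. v $ i)"

definition xprod :: "('n \<Rightarrow> 3) \<Rightarrow> real^'n \<Rightarrow> real^'n \<Rightarrow> real^3" where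
  "xprod \<iota> v w = cross3 (embed3 \<iota> v) (embed3 \<iota> w)"

definition cross_jump ::
  "('n \<Rightarrow> 3) \<Rightarrow> (real^'n) set set \<Rightarrow> (real^'n) set \<Rightarrow> real^'n \<Rightarrow>
   (real^'n \<Rightarrow> real^'n) \<Rightarrow> (real^'n \<Rightarrow> real^'n) \<Rightarrow> real^'n \<Rightarrow> real^3" where
  "cross_jump \<iota> Th e n u v x =
     xprod \<iota> (elem_trace (cell_behind Th e n) u x) (elem_trace (cell_behind Th e n) v x)
     - xprod \<iota> (elem_trace (cell_behind Th e (- n)) u x) (elem_trace (cell_behind Th e (- n)) v x)"

subsection \<open>The trilinear forms\<close>

text \<open>\<open>\<nu> e\<close> is the fixed unit normal of the face \<open>e\<close>.\<close>

definition a_form ::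
  "('n \<Rightarrow> 3) \<Rightarrow> (real^'n) set set \<Rightarrow> (real^'n) set \<Rightarrow> ((real^'n) set \<Rightarrow> real^'n) \<Rightarrow>
   (real^'n \<Rightarrow> real^'n) \<Rightarrow> (real^'n \<Rightarrow> real^'n) \<Rightarrow> (real^'n \<Rightarrow> real^'n) \<Rightarrow> real" where
  "a_form \<iota> Th \<Omega> \<nu> w u v =
     (\<Sum>K\<in>Th. LINT x:K|lebesgue.
        w x \<bullet> (frechet_derivative u (at x) (v x) - frechet_derivative v (at x) (u x)))
     + (\<Sum>e\<in>interior_faces Th \<Omega>. face_integral e (\<nu> e) (\<lambda>x.
          xprod \<iota> (\<nu> e) (avg Th e (\<nu> e) w x) \<bullet> cross_jump \<iota> Th e (\<nu> e) u v x))"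

definition b_form ::
  "(real^'n) set set \<Rightarrow> (real^'n) set \<Rightarrow> ((real^'n) set \<Rightarrow> real^'n) \<Rightarrow>
   (real^'n \<Rightarrow> real^'n) \<Rightarrow> (real^'n \<Rightarrow> real) \<Rightarrow> (real^'n \<Rightarrow> real) \<Rightarrow> real" where
  "b_form Th \<Omega> \<nu> u f g =
     (\<Sum>K\<in>Th. LINT x:K|lebesgue. (u x \<bullet> grad f x) * g x)
     - (\<Sum>e\<in>interior_faces Th \<Omega>. face_integral e (\<nu> e) (\<lambda>x.
          (avg Th e (\<nu> e) u x \<bullet> scalar_jump Th e (\<nu> e) f x) * avg Th e (\<nu> e) g x))"

text \<open>
  The integrand of the penalty term in the momentum equation. Since \<open>y / 0 = 0\<close>, the second
  summand is zero where \<open>u \<cdot> n = 0\<close>.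
\<close>

definition momentum_penalty ::
  "('n \<Rightarrow> 3) \<Rightarrow> (real^'n) set set \<Rightarrow> (real^'n) set \<Rightarrow> (real^'n \<Rightarrow> real) set \<Rightarrow>
   (real^'n) set \<Rightarrow> real^'n \<Rightarrow> (real^'n \<Rightarrow> real) \<Rightarrow> (real^'n \<Rightarrow> real) \<Rightarrow>
   (real^'n \<Rightarrow> real^'n) \<Rightarrow> (real^'n \<Rightarrow> real) \<Rightarrow> (real^'n \<Rightarrow> real^'n) \<Rightarrow> real^'n \<Rightarrow> real" where
  "momentum_penalty \<iota> Th \<Omega> F e n \<alpha> \<beta> u \<rho> v x =
     \<alpha> x * (xprod \<iota> n (vec_jump Th e n (\<lambda>y. \<rho> y *\<^sub>R u y) x)
              \<bullet> cross_jump \<iota> Th e n u v x)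
     + \<beta> x / (2 * \<bar>normal_comp Th e n u x\<bar>\<^sup>2) * (normal_comp Th e n u x * normal_comp Th e n v x)
         * (scalar_jump Th e n (L2_proj \<Omega> F (\<lambda>y. u y \<bullet> u y)) x \<bullet> scalar_jump Th e n \<rho> x)"

end

theory Submission
  imports Defs
begin

text \<open>
  On each element the weak divergence of \<open>u\<close> is almost everywhere the classical divergence of the
  polynomial that \<open>u\<close> agrees with, and this divergence has degree at most \<open>s\<close> for both
  Raviart-Thomas and BDM fields. So \<open>div u\<close> is represented by an element of \<open>DG\<^sub>s\<close>, which may
  be used as test function in the incompressibility equation: \<open>\<parallel>div u\<parallel>\<^sup>2 = 0\<close>.

  The identification with the classical divergence is made box by box, with product test functions
  built from \<open>exp (- 1 / t)\<close>. The interior of an element need not be contained in \<open>\<Omega>\<close>,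
  so it has to be intersected with \<open>\<Omega>\<close> first.
\<close>

subsection \<open>Polynomial spaces\<close>

lemma poly_spaceI:
  "(\<lambda>x. \<Sum>a | (\<Sum>i\<in>UNIV. a i) \<le> r. c a * (\<Prod>i\<in>UNIV. x $ i ^ a i)) \<in> poly_space r"
  unfolding poly_space_def by blast

text \<open>Every exponent is bounded by the total degree. Finiteness matters because a
  \<open>sum\<close> over an infinite set is 0 by convention, which would make the representation in
  \<open>poly_space\<close> collapse.\<close>

lemma finite_multi_indices: "finite {a :: 'n::finite \<Rightarrow> nat. (\<Sum>i\<in>UNIV. a i) \<le> r}"
proof (rule finite_subset)
  have "a i \<le> r" if "(\<Sum>j\<in>UNIV. a j) \<le> r" for a :: "'n \<Rightarrow> nat" and i
    using member_le_sum[of i UNIV a] that by simp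
  then show "{a :: 'n \<Rightarrow> nat. (\<Sum>i\<in>UNIV. a i) \<le> r} \<subseteq> PiE UNIV (\<lambda>_. {..r})"
    by auto
  show "finite (PiE (UNIV :: 'n set) (\<lambda>_. {..r}))"
    by (intro finite_PiE) auto
qed

lemma poly_space_zero: "(\<lambda>x. 0) \<in> poly_space r"
  using poly_spaceI[where c = "\<lambda>_. 0"] by simp

lemma poly_space_add:
  assumes "p \<in> poly_space r" "q \<in> poly_space r"
  shows "(\<lambda>x. p x + q x) \<in> poly_space r"
proof -
  from assms obtain c d where
    "p = (\<lambda>x. \<Sum>a | (\<Sum>i\<in>UNIV. a i) \<le> r. c a * (\<Prod>i\<in>UNIV. x $ i ^ a i))"
    "q = (\<lambda>x. \<Sum>a | (\<Sum>i\<in>UNIV. a i) \<le> r. d a * (\<Prod>i\<in>UNIV. x $ i ^ a i))"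
    unfolding poly_space_def by blast
  then show ?thesis
    using poly_spaceI[where c = "\<lambda>a. c a + d a"] by (simp add: sum.distrib distrib_right)
qed

lemma poly_space_cmult:
  assumes "p \<in> poly_space r"
  shows "(\<lambda>x. k * p x) \<in> poly_space r"
proof -
  from assms obtain c where
    "p = (\<lambda>x. \<Sum>a | (\<Sum>i\<in>UNIV. a i) \<le> r. c a * (\<Prod>i\<in>UNIV. x $ i ^ a i))"
    unfolding poly_space_def by blast
  then show ?thesis
    using poly_spaceI[where c = "\<lambda>a. k * c a"] by (simp add: sum_distrib_left mult.assoc)
qed

lemma poly_space_sum:
  assumes "\<And>j. j \<in> J \<Longrightarrow> p j \<in> poly_space r"
  shows "(\<lambda>x. \<Sum>j\<in>J. p j x) \<in> poly_space r"
  using assms by (induction J rule: infinite_finite_induct) (auto intro: poly_space_zero poly_space_add)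

lemma poly_space_monomial:
  assumes "(\<Sum>i\<in>UNIV. a i) \<le> r"
  shows "(\<lambda>x. \<Prod>i\<in>UNIV. x $ i ^ a i) \<in> poly_space r"
proof -
  have "(\<Sum>b | (\<Sum>i\<in>UNIV. b i) \<le> r. (if b = a then 1 else 0) * (\<Prod>i\<in>UNIV. x $ i ^ b i))
      = (\<Prod>i\<in>UNIV. x $ i ^ a i)" for x :: "real^'a"
    \<comment> \<open>The coefficient family is the indicator of the single multi-index
      \<open>a\<close>.\<close>
    by (subst sum.remove[OF finite_multi_indices, of a]) (auto simp: assms intro!: sum.neutral)
  then show ?thesis
    using poly_spaceI[of "\<lambda>b. if b = a then 1 else 0" r] by simp
qed

text \<open>Reduces claims about degrees and derivatives to linear closure and a check on monomials,
  so that coefficient families need not be handled again.\<close>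

lemma poly_space_induct [consumes 1, case_names zero add cmult monomial]:
  assumes "p \<in> poly_space r"
    and "P (\<lambda>x. 0)" "\<And>p q. P p \<Longrightarrow> P q \<Longrightarrow> P (\<lambda>x. p x + q x)"
    and "\<And>k p. P p \<Longrightarrow> P (\<lambda>x. k * p x)"
    and "\<And>a. (\<Sum>i\<in>UNIV. a i) \<le> r \<Longrightarrow> P (\<lambda>x. \<Prod>i\<in>UNIV. x $ i ^ a i)"
  shows "P p"
proof -
  from assms(1) obtain c where
    p: "p = (\<lambda>x. \<Sum>a | (\<Sum>i\<in>UNIV. a i) \<le> r. c a * (\<Prod>i\<in>UNIV. x $ i ^ a i))"
    unfolding poly_space_def by blast
  \<comment> \<open>Partial sums over subsets \<open>J\<close> of the admissible multi-indices make
    induction on the index set possible while the degree bound stays available for each inserted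
    index.\<close>
  have "P (\<lambda>x. \<Sum>a\<in>J. c a * (\<Prod>i\<in>UNIV. x $ i ^ a i))"
    if "J \<subseteq> {a. (\<Sum>i\<in>UNIV. a i) \<le> r}" for J
    using that by (induction J rule: infinite_finite_induct) (auto intro!: assms(2-5))
  then show ?thesis unfolding p by blast
qed

section \<open>Gradients of products, monomials and polynomials\<close>

lemma grad_nth:
  assumes "(f has_derivative f') (at x)"
  shows "grad f x $ i = f' (axis i 1)"
  using frechet_derivative_at[OF assms] by (simp add: grad_def)

lemma grad_nth_mult:
  assumes "f differentiable at x" "g differentiable at x"
  shows "grad (\<lambda>x. f x * g x) x $ i = f x * grad g x $ i + grad f x $ i * g x"
  using grad_nth[OF has_derivative_mult[OF assms[THEN frechet_derivative_works[THEN iffD1]]]]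
  by (simp add: grad_def)

lemma grad_nth_add:
  assumes "f differentiable at x" "g differentiable at x"
  shows "grad (\<lambda>x. f x + g x) x $ i = grad f x $ i + grad g x $ i"
  using grad_nth[OF has_derivative_add[OF assms[THEN frechet_derivative_works[THEN iffD1]]]]
  by (simp add: grad_def)

lemma grad_nth_const: "grad (\<lambda>x. c) x $ i = 0"
  by (simp add: grad_def)

lemma grad_nth_coordinate: "grad (\<lambda>x. x $ j) x $ i = (if i = j then 1 else 0)"
  using grad_nth[OF bounded_linear_imp_has_derivative[OF bounded_linear_vec_nth], of j x i]
  by (simp add: axis_def)

lemma has_derivative_monomial:
  "((\<lambda>x::real^'n. \<Prod>i\<in>UNIV. x $ i ^ a i) has_derivative
     (\<lambda>h. \<Sum>i\<in>UNIV. (a i * h $ i * x $ i ^ (a i - 1)) * (\<Prod>j\<in>UNIV - {i}. x $ j ^ a j))) (at x)"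
  by (rule has_derivative_eq_rhs, (rule derivative_eq_intros bounded_linear_imp_has_derivative
        bounded_linear_vec_nth refl)+)

text \<open>For \<open>a i = 0\<close> the truncated subtraction leaves the exponent at 0, and the
  factor \<open>a i\<close> still makes the right-hand side vanish, so the formula holds
  uniformly.\<close>

lemma grad_monomial:
  "grad (\<lambda>x. \<Prod>i\<in>UNIV. x $ i ^ a i) x $ i = a i * (\<Prod>j\<in>UNIV. x $ j ^ (a(i := a i - 1)) j)"
proof -
  have "(\<Prod>j\<in>UNIV. x $ j ^ (a(i := a i - 1)) j) = x $ i ^ (a i - 1) * (\<Prod>j\<in>UNIV - {i}. x $ j ^ a j)"
    by (subst prod.remove[of _ i]) auto
  moreover have "(\<Sum>k\<in>UNIV. (a k * axis i (1::real) $ k * x $ k ^ (a k - 1)) * (\<Prod>j\<in>UNIV - {k}. x $ j ^ a j))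
     = a i * x $ i ^ (a i - 1) * (\<Prod>j\<in>UNIV - {i}. x $ j ^ a j)"
    by (subst sum.remove[of _ i]) (auto simp: axis_def intro!: sum.neutral)
  ultimately show ?thesis
    by (simp add: grad_nth[OF has_derivative_monomial])
qed

lemma poly_space_differentiable:
  assumes "p \<in> poly_space r"
  shows "p differentiable at x"
  using assms
proof (induction rule: poly_space_induct)
  case (monomial a)
  then show ?case using has_derivative_monomial differentiable_def by blast
qed auto

lemma poly_space_continuous:
  "p \<in> poly_space r \<Longrightarrow> continuous_on S p"
  by (meson differentiable_imp_continuous_on differentiable_on_def differentiable_at_withinI
      poly_space_differentiable)

lemma sum_multi_index_decrement:
  fixes a :: "'n::finite \<Rightarrow> nat"
  assumes "a i \<noteq> 0"
  shows "Suc (\<Sum>j\<in>UNIV. (a(i := a i - 1)) j) = (\<Sum>j\<in>UNIV. a j)"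
  using assms by (subst (1 2) sum.remove[of _ i]) auto

lemma poly_space_grad:
  assumes "p \<in> poly_space (Suc r)"
  shows "(\<lambda>x. grad p x $ i) \<in> poly_space r"
proof -
  \<comment> \<open>Differentiability is carried through the induction because the sum and product
    rules for \<open>grad\<close> require it and the induction hypotheses do not retain membership
    in the polynomial space.\<close>
  have "(\<forall>x. p differentiable at x) \<and> (\<lambda>x. grad p x $ i) \<in> poly_space r"
    using assms
  proof (induction rule: poly_space_induct)
    case zero
    then show ?case by (simp add: grad_nth_const poly_space_zero)
  next
    case (add p q)
    then show ?case by (simp add: grad_nth_add poly_space_add)
  next
    case (cmult k p)
    then show ?case by (simp add: grad_nth_mult grad_nth_const poly_space_cmult)
  next
    case (monomial a)
    have "(\<lambda>x. a i * (\<Prod>j\<in>UNIV. x $ j ^ (a(i := a i - 1)) j)) \<in> poly_space r"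
    \<comment> \<open>If \<open>a i = 0\<close>, the subtraction does not lower the degree, but the
      leading factor is zero. Otherwise the degree drops by exactly one.\<close>
    proof (cases "a i = 0")
      case False
      with monomial sum_multi_index_decrement[of a i] show ?thesis
        by (intro poly_space_cmult poly_space_monomial) linarith
    qed (simp add: poly_space_zero)
    then show ?case
      using monomial poly_space_differentiable[OF poly_space_monomial]
      by (simp only: grad_monomial) blast
  qed
  then show ?thesis ..
qed

text \<open>Monomials are eigenvectors of this one-coordinate Euler operator with eigenvalue
  \<open>a i\<close>, so the degree does not grow. This controls the Raviart-Thomas term
  \<open>q x *\<^sub>R x\<close>.\<close>

lemma poly_space_coordinate_grad:
  assumes "p \<in> poly_space r"
  shows "(\<lambda>x. x $ i * grad p x $ i) \<in> poly_space r"
proof -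
  have "(\<forall>x. p differentiable at x) \<and> (\<lambda>x. x $ i * grad p x $ i) \<in> poly_space r"
    using assms
  proof (induction rule: poly_space_induct)
    case zero
    then show ?case by (simp add: grad_nth_const poly_space_zero)
  next
    case (add p q)
    then show ?case by (simp add: grad_nth_add poly_space_add distrib_left)
  next
    case (cmult k p)
    then show ?case
      by (simp add: grad_nth_mult grad_nth_const poly_space_cmult mult.left_commute)
  next
    case (monomial a)
    have "x $ i * (a i * (\<Prod>j\<in>UNIV. x $ j ^ (a(i := a i - 1)) j))
        = a i * (\<Prod>j\<in>UNIV. x $ j ^ a j)" for x :: "real^'a"
      by (cases "a i") (simp_all add: prod.remove[of _ i])
    then have "(\<lambda>x. x $ i * grad (\<lambda>x. \<Prod>j\<in>UNIV. x $ j ^ a j) x $ i) \<in> poly_space r"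
      using poly_space_cmult[OF poly_space_monomial[OF monomial], of "real (a i)"]
      by (simp only: grad_monomial)
    then show ?case
      using monomial poly_space_differentiable[OF poly_space_monomial] by blast
  qed
  then show ?thesis ..
qed

lemma poly_space_mono:
  assumes "p \<in> poly_space r" "r \<le> r'"
  shows "p \<in> poly_space r'"
  using assms(1)
  by (induction rule: poly_space_induct)
     (use assms(2) in \<open>auto intro: poly_space_zero poly_space_add poly_space_cmult poly_space_monomial\<close>)

lemma poly_space_mult_coordinate:
  assumes "p \<in> poly_space r"
  shows "(\<lambda>x. p x * x $ i) \<in> poly_space (Suc r)"
  using assms
proof (induction rule: poly_space_induct)
  case (monomial a)
  have "(\<Prod>j\<in>UNIV. x $ j ^ a j) * x $ i = (\<Prod>j\<in>UNIV. x $ j ^ (a(i := Suc (a i))) j)"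
    for x :: "real^'a"
    by (simp add: prod.remove[of _ i])
  moreover have "(\<Sum>j\<in>UNIV. (a(i := Suc (a i))) j) = Suc (\<Sum>j\<in>UNIV. a j)"
    by (simp add: sum.remove[of _ i])
  ultimately show ?case
    using poly_space_monomial[of "a(i := Suc (a i))" "Suc r"] monomial by simp
qed (auto simp: distrib_right mult.assoc intro: poly_space_zero poly_space_add poly_space_cmult)

subsection \<open>Smooth bump functions on boxes\<close>

lemma Ck_on_SucI:
  assumes "\<And>x. (f has_derivative f' x) (at x)" "\<And>i. Ck_on k UNIV (\<lambda>x. f' x (axis i 1))"
  shows "Ck_on (Suc k) UNIV f"
  using assms by (auto simp: grad_nth[OF assms(1)] differentiable_def)

lemma Ck_on_SucD: "Ck_on (Suc k) S f \<Longrightarrow> Ck_on k S f"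
proof (induction k arbitrary: f)
  case 0
  then show ?case
    by (auto intro!: continuous_at_imp_continuous_on differentiable_imp_continuous_within)
qed auto

lemma Ck_on_const: "Ck_on k UNIV (\<lambda>x. c)"
  by (induction k arbitrary: c) (auto simp: grad_nth_const)

lemma Ck_on_add:
  "Ck_on k UNIV f \<Longrightarrow> Ck_on k UNIV g \<Longrightarrow> Ck_on k UNIV (\<lambda>x. f x + g x)"
  by (induction k arbitrary: f g) (auto simp: grad_nth_add intro: continuous_on_add)

text \<open>The product rule places undifferentiated factors next to gradients. The induction
  hypothesis therefore needs \<open>f\<close> and \<open>g\<close> themselves at the lower order,
  which \<open>Ck_on_SucD\<close> supplies.\<close>

lemma Ck_on_mult:
  "Ck_on k UNIV f \<Longrightarrow> Ck_on k UNIV g \<Longrightarrow> Ck_on k UNIV (\<lambda>x. f x * g x)"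
proof (induction k arbitrary: f g)
  case 0
  then show ?case by (auto intro: continuous_on_mult)
next
  case (Suc k)
  note f = Ck_on_SucD[OF Suc.prems(1)] and g = Ck_on_SucD[OF Suc.prems(2)]
  show ?case
    using Suc.prems by (auto simp: grad_nth_mult intro!: Ck_on_add Suc.IH f g)
qed

lemma Ck_on_prod:
  "(\<And>j. j \<in> J \<Longrightarrow> Ck_on k UNIV (f j)) \<Longrightarrow> Ck_on k UNIV (\<lambda>x. \<Prod>j\<in>J. f j x)"
  by (induction J rule: infinite_finite_induct) (auto intro: Ck_on_const Ck_on_mult)

text \<open>The family \<open>F\<close> lists the successive derivatives of one function. Each
  partial derivative moves from \<open>F n\<close> to \<open>F (Suc n)\<close> times a constant,
  which is why the induction on \<open>k\<close> keeps \<open>n\<close> arbitrary.\<close>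

lemma Ck_on_compose_affine_coordinate:
  assumes "\<And>n t. (F n has_real_derivative F (Suc n) t) (at t)"
  shows "Ck_on k UNIV (\<lambda>x. F n (c * x $ i + d))"
proof (induction k arbitrary: n)
  case 0
  have "continuous_on UNIV (F n)"
    using assms by (meson DERIV_continuous_on)
  then show ?case
    by (auto intro!: continuous_intros continuous_on_compose2[of UNIV "F n"])
next
  case (Suc k)
  have "((\<lambda>x. F n (c * x $ i + d)) has_derivative (\<lambda>h. F (Suc n) (c * x $ i + d) * (c * h $ i))) (at x)"
    for x :: "real^'a"
    by (rule has_derivative_compose[of "\<lambda>x. c * x $ i + d" "\<lambda>h. c * h $ i", OF _
            assms[unfolded has_field_derivative_def]])
       (auto intro!: derivative_eq_intros bounded_linear_imp_has_derivative bounded_linear_vec_nth)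
  then show ?case
    by (rule Ck_on_SucI) (intro Ck_on_mult Suc.IH Ck_on_const)
qed

lemma Ck_on_0D: "Ck_on k S f \<Longrightarrow> continuous_on S f"
  by (induction k) (auto dest: Ck_on_SucD simp del: Ck_on.simps(2))

text \<open>The derivatives of \<open>exp (- 1 / t)\<close> are again of the form \<open>p (1 / t) * exp (- 1 / t)\<close>
  with a polynomial \<open>p\<close>, and all these functions are flat at \<open>0\<close>.\<close>

definition flat_exp :: "real poly \<Rightarrow> real \<Rightarrow> real" where
  "flat_exp p t = (if t > 0 then poly p (1 / t) * exp (- (1 / t)) else 0)"

lemma tendsto_poly_div_exp_0: "((\<lambda>y. poly p y / exp y) \<longlongrightarrow> (0::real)) at_top"
proof -
  have "((\<lambda>y. \<Sum>i\<le>degree p. coeff p i * (y ^ i / exp y)) \<longlongrightarrow> (\<Sum>i\<le>degree p. coeff p i * (0::real))) at_top"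
    by (intro tendsto_intros tendsto_power_div_exp_0)
  then show ?thesis
    by (simp add: poly_altdef sum_divide_distrib)
qed

lemma tendsto_flat_exp_at_right_0: "(flat_exp p \<longlongrightarrow> 0) (at_right 0)"
proof -
  have "((\<lambda>t. poly p (inverse t) / exp (inverse t)) \<longlongrightarrow> 0) (at_right 0)"
    by (rule filterlim_compose[OF tendsto_poly_div_exp_0 filterlim_inverse_at_top_right])
  moreover have "\<forall>\<^sub>F t in at_right 0. poly p (inverse t) / exp (inverse t) = flat_exp p t"
    by (auto simp: eventually_at_filter flat_exp_def exp_minus field_simps)
  ultimately show ?thesis
    by (rule Lim_transform_eventually)
qed

text \<open>With y = 1/t, one has dy/dt = -y^2, so p(y) exp(-y) has derivative y^2 (p(y) - p'(y))
  exp(-y).\<close>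

definition flat_exp_deriv :: "real poly \<Rightarrow> real poly" where
  "flat_exp_deriv p = monom 1 2 * (p - pderiv p)"

lemma flat_exp_has_derivative:
  "(flat_exp p has_real_derivative flat_exp (flat_exp_deriv p) t) (at t)"
proof (cases t "0::real" rule: linorder_cases)
  case greater
  have "((\<lambda>t. poly p (1 / t) * exp (- (1 / t))) has_real_derivative flat_exp (flat_exp_deriv p) t) (at t)"
    using greater
    by (auto intro!: derivative_eq_intros DERIV_chain2[OF poly_DERIV]
        simp: flat_exp_def flat_exp_deriv_def poly_monom field_simps power2_eq_square)
  then show ?thesis
    by (rule has_field_derivative_transform_within_open[where S = "{0<..}"])
       (use greater in \<open>auto simp: flat_exp_def\<close>)
next
  case less
  have "((\<lambda>t. 0) has_real_derivative flat_exp (flat_exp_deriv p) t) (at t)"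
    using less by (simp add: flat_exp_def)
  then show ?thesis
    by (rule has_field_derivative_transform_within_open[where S = "{..<0}"])
       (use less in \<open>auto simp: flat_exp_def\<close>)
next
  case equal
  \<comment> \<open>Dividing by \<open>t\<close> multiplies the polynomial in \<open>1 / t\<close>
    by its variable. The difference quotient at 0 is thus \<open>flat_exp (pCons 0 p)\<close> on the
    right, which tends to 0.\<close>
  have "((\<lambda>t. flat_exp p t / t) \<longlongrightarrow> 0) (at_right 0)"
    by (rule Lim_transform_eventually[OF tendsto_flat_exp_at_right_0[of "pCons 0 p"]])
       (auto simp: eventually_at_filter flat_exp_def)
  moreover have "((\<lambda>t. flat_exp p t / t) \<longlongrightarrow> 0) (at_left 0)"
    by (rule Lim_transform_eventually[OF tendsto_const])
       (auto simp: eventually_at_filter flat_exp_def)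
  ultimately have "((\<lambda>t. flat_exp p t / t) \<longlongrightarrow> 0) (at 0)"
    by (simp add: filterlim_split_at)
  then show ?thesis
    using equal by (simp add: has_field_derivative_iff flat_exp_def)
qed

text \<open>Iterating \<open>flat_exp_deriv\<close> provides the whole sequence of
  derivatives.\<close>

lemma Ck_on_flat_exp: "Ck_on k UNIV (\<lambda>x. flat_exp p (c * x $ i + d))"
  using Ck_on_compose_affine_coordinate[of "\<lambda>n. flat_exp ((flat_exp_deriv ^^ n) p)" k 0]
    flat_exp_has_derivative by simp

text \<open>As \<open>k\<close> tends to infinity, these test functions increase to the indicator of the box.\<close>

definition box_bump :: "real^'n \<Rightarrow> real^'n \<Rightarrow> nat \<Rightarrow> real^'n \<Rightarrow> real" where
  "box_bump a b k x =
     (\<Prod>i\<in>UNIV. flat_exp 1 (real (Suc k) * (x $ i - a $ i)) * flat_exp 1 (real (Suc k) * (b $ i - x $ i)))"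

lemma smooth_box_bump: "smooth_on UNIV (box_bump a b k)"
proof -
  have "Ck_on l UNIV (\<lambda>x. \<Prod>i\<in>UNIV. flat_exp 1 (real (Suc k) * x $ i + (- real (Suc k) * a $ i))
      * flat_exp 1 ((- real (Suc k)) * x $ i + real (Suc k) * b $ i))" for l
    by (intro Ck_on_prod Ck_on_mult Ck_on_flat_exp)
  then show ?thesis
    unfolding smooth_on_def box_bump_def by (simp add: algebra_simps)
qed

lemma flat_exp_bounds: "0 \<le> flat_exp 1 t" "flat_exp 1 t \<le> 1"
  by (auto simp: flat_exp_def)

lemma box_bump_bounds: "0 \<le> box_bump a b k x" "box_bump a b k x \<le> 1"
  unfolding box_bump_def
  by (auto intro!: prod_nonneg prod_le_1 mult_le_one simp: flat_exp_bounds)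

lemma abs_mult_box_bump_le: "\<bar>c * box_bump a b k x\<bar> \<le> \<bar>c\<bar>"
  using mult_left_le[OF box_bump_bounds(2) abs_ge_zero[of c]]
  by (simp only: abs_mult abs_of_nonneg[OF box_bump_bounds(1)])

lemma box_bump_eq_0: "x \<notin> box a b \<Longrightarrow> box_bump a b k x = 0"
  by (auto simp: box_bump_def mem_box_cart flat_exp_def zero_less_mult_iff)

lemma box_bump_tendsto: "(\<lambda>k. box_bump a b k x) \<longlonglongrightarrow> indicator (box a b) x"
proof (cases "x \<in> box a b")
  case True
  \<comment> \<open>Inside the open box every distance to a face is positive. Scaling it by
    \<open>Suc k\<close> sends the exponent \<open>- 1 / (Suc k * t)\<close> to 0, so each factor
    tends to 1.\<close>
  have *: "(\<lambda>k. flat_exp 1 (real (Suc k) * t)) \<longlonglongrightarrow> 1" if "t > 0" for t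
  proof -
    have "(\<lambda>k. exp (- (inverse (real (Suc k)) * (1 / t)))) \<longlonglongrightarrow> exp (- (0 * (1 / t)))"
      by (intro tendsto_intros LIMSEQ_inverse_real_of_nat)
    then show ?thesis
      using that by (simp add: flat_exp_def divide_simps)
  qed
  have "(\<lambda>k. box_bump a b k x) \<longlonglongrightarrow> (\<Prod>i\<in>(UNIV::'a set). 1 * 1)"
    unfolding box_bump_def
    by (intro tendsto_intros *) (use True in \<open>auto simp: mem_box_cart\<close>)
  then show ?thesis using True by simp
qed (simp add: box_bump_eq_0)

text \<open>The support is a closure and may reach the faces of the box, hence the hypothesis on the
  closed box.\<close>

lemma box_bump_test_function:
  assumes "cbox a b \<subseteq> \<Omega>"
  shows "box_bump a b k \<in> test_functions \<Omega>"
proof -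
  have "closure {x. box_bump a b k x \<noteq> 0} \<subseteq> cbox a b"
    by (rule closure_minimal) (use box_bump_eq_0 box_subset_cbox in \<open>fastforce+\<close>)
  moreover from this have "compact (closure {x. box_bump a b k x \<noteq> 0})"
    by (meson bounded_cbox bounded_subset closed_closure compact_eq_bounded_closed)
  ultimately show ?thesis
    using assms smooth_box_bump unfolding test_functions_def by blast
qed

subsection \<open>Integration by parts\<close>

lemma integrable_continuous_bounded_support:
  fixes f :: "'a::euclidean_space \<Rightarrow> real"
  assumes "continuous_on UNIV f" "\<And>x. x \<notin> cball 0 R \<Longrightarrow> f x = 0"
  shows "integrable lborel f"
proof -
  have "integrable lborel (\<lambda>x. indicator (cball 0 R) x *\<^sub>R f x)"
    by (rule borel_integrable_compact) (auto intro: continuous_on_subset[OF assms(1)])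
  also have "(\<lambda>x. indicator (cball 0 R) x *\<^sub>R f x) = f"
    using assms(2) by (auto simp: indicator_def fun_eq_iff)
  finally show ?thesis .
qed

lemma integral_translation:
  fixes f :: "'a::euclidean_space \<Rightarrow> real"
  assumes "f \<in> borel_measurable borel"
  shows "integral\<^sup>L lborel (\<lambda>x. f (x + c)) = integral\<^sup>L lborel f"
proof -
  have "integral\<^sup>L lborel f = integral\<^sup>L (distr lborel borel ((+) c)) f"
    by (simp add: lborel_distr_plus)
  also have "\<dots> = integral\<^sup>L lborel (\<lambda>x. f (c + x))"
    by (rule integral_distr) (use assms in auto)
  finally show ?thesis by (simp add: add.commute)
qed

text \<open>Restriction to a line parallel to an axis makes the one-variable mean value theorem
  applicable to difference quotients.\<close>

lemma has_derivative_along_axis: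
  assumes "f differentiable at (x + t *\<^sub>R axis i 1)"
  shows "((\<lambda>t. f (x + t *\<^sub>R axis i 1)) has_real_derivative grad f (x + t *\<^sub>R axis i 1) $ i) (at t)"
proof -
  let ?x = "x + t *\<^sub>R axis i 1"
  have "((\<lambda>t. x + t *\<^sub>R axis i 1) has_derivative (\<lambda>h. h *\<^sub>R axis i 1)) (at t)"
    by (auto intro!: derivative_eq_intros)
  then have "((\<lambda>t. f (x + t *\<^sub>R axis i 1)) has_derivative
      (\<lambda>h. frechet_derivative f (at ?x) (h *\<^sub>R axis i 1))) (at t)"
    by (rule has_derivative_compose) (use assms frechet_derivative_works in blast)
  moreover have "frechet_derivative f (at ?x) (h *\<^sub>R axis i 1) = grad f ?x $ i * h" for h
    using linear_cmul[OF linear_frechet_derivative[OF assms]] by (simp add: grad_def mult.commute)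
  ultimately show ?thesis
    by (simp add: has_field_derivative_def)
qed

text \<open>The difference quotients of \<open>f\<close> in a coordinate direction have integral zero by
  translation invariance; dominated convergence passes to the limit.\<close>

lemma integral_partial_derivative_eq_0:
  fixes f :: "real^'n \<Rightarrow> real"
  assumes f: "Ck_on 1 UNIV f" and supp: "\<And>x. x \<notin> cball 0 R \<Longrightarrow> f x = 0"
  shows "integral\<^sup>L lborel (\<lambda>x. grad f x $ i) = 0"
proof -
  define h where "h k = inverse (real (Suc k))" for k
  have h: "0 < h k" "h k \<le> 1" for k
    by (auto simp: h_def divide_simps)
  have diff: "f differentiable at x" for x
    using f by auto
  have cont_grad: "continuous_on UNIV (\<lambda>x. grad f x $ i)"
    using f by auto
  have cont: "continuous_on UNIV f"
    using f by (rule Ck_on_0D)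
  have meas [measurable]: "f \<in> borel_measurable borel"
    using cont by (rule borel_measurable_continuous_onI)
  have meas_grad [measurable]: "(\<lambda>x. grad f x $ i) \<in> borel_measurable borel"
    using cont_grad by (rule borel_measurable_continuous_onI)
  define q where "q k x = (f (x + h k *\<^sub>R axis i 1) - f x) / h k" for k x
  \<comment> \<open>The quotients vanish outside the ball of radius \<open>R + 1\<close>. A step of
    length at most 1 from that ball stays within radius \<open>R + 2\<close>, so \<open>M\<close>
    bounds every derivative that occurs.\<close>
  have "compact ((\<lambda>x. grad f x $ i) ` cball 0 (R + 2))"
    by (intro compact_continuous_image continuous_on_subset[OF cont_grad]) auto
  then obtain M where M: "\<And>x. x \<in> cball 0 (R + 2) \<Longrightarrow> \<bar>grad f x $ i\<bar> \<le> M"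
    by (force dest: compact_imp_bounded simp: bounded_iff)
  have int_f: "integrable lborel f"
    by (rule integrable_continuous_bounded_support[OF cont supp])
  have "integrable lborel (\<lambda>x. f (x + c))" for c
  proof (rule integrable_continuous_bounded_support)
    show "continuous_on UNIV (\<lambda>x. f (x + c))"
      by (intro continuous_on_compose2[OF cont] continuous_intros) auto
    show "f (x + c) = 0" if "x \<notin> cball 0 (R + norm c)" for x
      using that norm_diff_ineq[of x c] by (intro supp) (auto simp: not_le)
  qed
  then have "integral\<^sup>L lborel (q k) = 0" for k
    unfolding q_def using int_f integral_translation[OF meas] by simp
  moreover have "(\<lambda>k. integral\<^sup>L lborel (q k)) \<longlonglongrightarrow> integral\<^sup>L lborel (\<lambda>x. grad f x $ i)"
  proof (rule integral_dominated_convergence)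
    show "integrable lborel (\<lambda>x. indicator (cball 0 (R + 1)) x *\<^sub>R M)"
      by (rule borel_integrable_compact) auto
    show "q k \<in> borel_measurable lborel" for k
      unfolding q_def by measurable
    have "(\<lambda>k. q k x) \<longlonglongrightarrow> grad f x $ i" for x
    proof -
      have "((\<lambda>t. (f (x + t *\<^sub>R axis i 1) - f x) / t) \<longlongrightarrow> grad f x $ i) (at 0)"
        using has_derivative_along_axis[of f x 0 i] diff
        by (simp add: has_field_derivative_iff)
      moreover have "filterlim h (at 0) sequentially"
        unfolding filterlim_at h_def
        using LIMSEQ_inverse_real_of_nat by (auto simp: eventually_sequentially)
      ultimately show ?thesis
        unfolding q_def by (rule filterlim_compose)
    qed
    then show "AE x in lborel. (\<lambda>k. q k x) \<longlonglongrightarrow> grad f x $ i" by simp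
    show "AE x in lborel. norm (q k x) \<le> indicator (cball 0 (R + 1)) x *\<^sub>R M" for k
    proof (rule AE_I2)
      fix x :: "real^'n"
      show "norm (q k x) \<le> indicator (cball 0 (R + 1)) x *\<^sub>R M"
      proof (cases "x \<in> cball 0 (R + 1)")
        case True
        \<comment> \<open>By the mean value theorem the quotient is a partial derivative at an
          intermediate point, bounded by \<open>M\<close> uniformly in \<open>k\<close>.\<close>
        obtain t where t: "0 < t" "t < h k"
          and eq: "f (x + h k *\<^sub>R axis i 1) - f (x + 0 *\<^sub>R axis i 1)
            = (h k - 0) * grad f (x + t *\<^sub>R axis i 1) $ i"
          using MVT2[OF h(1) has_derivative_along_axis[OF diff]] by blast
        have "norm (x + t *\<^sub>R axis i 1) \<le> R + 2"
          using norm_triangle_ineq[of x "t *\<^sub>R axis i 1"] True t h(2)[of k] by (simp add: norm_axis_1)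
        then have "\<bar>grad f (x + t *\<^sub>R axis i 1) $ i\<bar> \<le> M"
          by (intro M) simp
        then show ?thesis
          using True eq h(1)[of k] by (simp add: q_def)
      next
        case False
        \<comment> \<open>As \<open>h k \<le> 1\<close>, both points of the quotient lie outside the
          ball that supports \<open>f\<close>.\<close>
        then have "x \<notin> cball 0 R" "x + h k *\<^sub>R axis i 1 \<notin> cball 0 R"
          using norm_diff_ineq[of x "h k *\<^sub>R axis i 1"] h[of k] by (auto simp: norm_axis_1)
        then show ?thesis
          using False by (simp add: q_def supp)
      qed
    qed
  qed auto
  ultimately show ?thesis
    by (simp add: LIMSEQ_const_iff)
qed

text \<open>Open boxes form an intersection-stable generator of the Borel sets, and the sets over
  which \<open>f\<close> integrates to zero form a Dynkin system. Closure under complements is where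
  the total integral enters. Uniqueness of densities then compares \<open>f\<close> with 0.\<close>

lemma AE_eq_0_if_box_integrals_eq_0:
  fixes f :: "'a::euclidean_space \<Rightarrow> real"
  assumes f: "integrable lebesgue f" and total: "integral\<^sup>L lebesgue f = 0"
    and box: "\<And>a b. (LINT x:box a b|lebesgue. f x) = 0"
  shows "AE x in lebesgue. f x = 0"
proof (rule density_unique_real[OF f, of "\<lambda>x. 0"])
  have set_int: "set_integrable lebesgue A f" if "A \<in> sets lebesgue" for A
    using that f unfolding set_integrable_def by (rule integrable_mult_indicator)
  have borel: "(LINT x:A|lebesgue. f x) = 0" if "A \<in> sets borel" for A :: "'a set"
  proof -
    have "Int_stable (range (\<lambda>(a, b). box a b :: 'a set))"
      by (auto simp: Int_stable_def box_Int_box)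
    moreover have "range (\<lambda>(a, b). box a b :: 'a set) \<subseteq> Pow UNIV"
      by auto
    moreover have "A \<in> sigma_sets UNIV (range (\<lambda>(a, b). box a b))"
      using that unfolding borel_eq_box by simp
    ultimately show ?thesis
    proof (induction rule: sigma_sets_induct_disjoint)
      case (basic A)
      then show ?case using box by auto
    next
      case empty
      then show ?case by (simp add: set_lebesgue_integral_def)
    next
      case (compl A)
      then have "A \<in> sets lebesgue"
        by (simp add: borel_eq_box)
      then have "(LINT x:A \<union> (UNIV - A)|lebesgue. f x)
          = (LINT x:A|lebesgue. f x) + (LINT x:UNIV - A|lebesgue. f x)"
        by (intro set_integral_Un set_int) auto
      then show ?case
        using compl total by (simp add: set_lebesgue_integral_def)
    next
      case (union A)
      then have "A k \<in> sets borel" for k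
        unfolding borel_eq_box by auto
      then have A: "A k \<in> sets lebesgue" for k
        by simp
      have "(LINT x:(\<Union>k. A k)|lebesgue. f x) = (\<Sum>k. LINT x:A k|lebesgue. f x)"
        using union(1) A
        by (intro lebesgue_integral_countable_add set_int) (auto simp: disjoint_family_on_def)
      then show ?case using union by simp
    qed
  qed
  show "(LINT x:A|lebesgue. f x) = (LINT x:A|lebesgue. 0)" if A: "A \<in> sets lebesgue" for A
  proof -
    \<comment> \<open>A Lebesgue set is a Borel set up to a null set, which leaves the integral
      unchanged.\<close>
    obtain S N N' where S: "A = S \<union> N" "N \<subseteq> N'" "N' \<in> null_sets lborel" "S \<in> sets lborel"
      using A by (rule sets_completionE)
    have "AE x in lebesgue. x \<notin> N'"
      using S(3) by (intro AE_not_in null_sets_completionI)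
    then have "AE x in lebesgue. (x \<in> A) = (x \<in> S)"
      by eventually_elim (use S in auto)
    then have "(LINT x:A|lebesgue. f x) = (LINT x:S|lebesgue. f x)"
      using A S(4) f[THEN borel_measurable_integrable]
      by (intro set_integral_cong_set)
         (auto simp: set_borel_measurable_def intro!: borel_measurable_times borel_measurable_indicator)
    then show ?thesis
      using borel S(4) by (simp add: set_lebesgue_integral_def)
  qed
qed auto

subsection \<open>Weak and classical divergence\<close>

definition divergence :: "(real^'n \<Rightarrow> real^'n) \<Rightarrow> real^'n \<Rightarrow> real" where
  "divergence P x = (\<Sum>i\<in>UNIV. grad (\<lambda>y. P y $ i) x $ i)"

lemma continuous_on_divergence:
  assumes "\<And>i. Ck_on 1 UNIV (\<lambda>x. P x $ i)"
  shows "continuous_on UNIV (divergence P)"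
proof -
  have "continuous_on UNIV (\<lambda>x. \<Sum>i\<in>UNIV. grad (\<lambda>y. P y $ i) x $ i)"
    using assms by (intro continuous_on_sum) auto
  then show ?thesis unfolding divergence_def .
qed

text \<open>On a set of finite measure \<open>1 + (d x)\<^sup>2\<close> is integrable. It dominates
  \<open>\<bar>d x\<bar>\<close> because the square of \<open>\<bar>d x\<bar> - 1\<close> is
  nonnegative.\<close>

lemma L2_set_integrable:
  fixes d :: "real^'n \<Rightarrow> real"
  assumes d: "d \<in> L2 \<Omega>" and \<Omega>: "\<Omega> \<in> sets lebesgue" and A: "A \<subseteq> \<Omega>" "A \<in> lmeasurable"
  shows "set_integrable lebesgue A d"
proof (rule set_integrable_bound)
  have "set_integrable lebesgue \<Omega> (\<lambda>x. (d x)\<^sup>2)"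
    using d \<Omega> by (simp add: L2_def set_integrable_def integrable_restrict_space)
  then have "set_integrable lebesgue A (\<lambda>x. (d x)\<^sup>2)"
    by (rule set_integrable_subset) (use A in auto)
  moreover have "set_integrable lebesgue A (\<lambda>x. 1::real)"
    using A by (auto simp: set_integrable_def fmeasurable_def intro!: integrable_real_indicator)
  ultimately show "set_integrable lebesgue A (\<lambda>x. 1 + (d x)\<^sup>2)"
    by (intro set_integral_add)
  have "set_borel_measurable lebesgue \<Omega> d"
    using d \<Omega> by (simp add: L2_def set_borel_measurable_def borel_measurable_restrict_space_iff)
  then show "set_borel_measurable lebesgue A d"
    by (rule set_borel_measurable_subset) (use A in auto)
  have "\<bar>d x\<bar> \<le> 1 + (d x)\<^sup>2" for x
    using zero_le_power2[of "\<bar>d x\<bar> - 1"] by (simp add: power2_diff)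
  then show "AE x in lebesgue. x \<in> A \<longrightarrow> norm (d x) \<le> norm (1 + (d x)\<^sup>2)"
    by (auto simp: abs_of_nonneg add_nonneg_nonneg)
qed

lemma grad_eq_0_outside_cbox:
  assumes "\<And>y. y \<notin> box a b \<Longrightarrow> f y = 0" "x \<notin> cbox a b"
  shows "grad f x = 0"
proof -
  have "((\<lambda>_. 0) has_derivative (\<lambda>_. 0)) (at x)"
    by simp
  then have "(f has_derivative (\<lambda>_. 0)) (at x)"
    by (rule has_derivative_transform_within_open[OF _ open_Compl[OF closed_cbox[of a b]]])
       (use assms box_subset_cbox[of a b] in auto)
  then show ?thesis
    by (simp add: vec_eq_iff grad_nth)
qed

lemma grad_box_bump_eq_0: "x \<notin> cbox a b \<Longrightarrow> grad (box_bump a b k) x = 0"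
  by (rule grad_eq_0_outside_cbox) (auto simp: box_bump_eq_0)

lemma continuous_on_box_bump: "continuous_on UNIV (box_bump a b k)"
  using smooth_box_bump[of a b k] Ck_on_0D unfolding smooth_on_def by blast

lemma borel_measurable_box_bump: "box_bump a b k \<in> borel_measurable lebesgue"
  using borel_measurable_continuous_onI[OF continuous_on_box_bump] by (intro measurable_completion) simp

text \<open>Each product of a component of \<open>P\<close> with the bump has bounded support, so
  the integral of its partial derivative is zero. The product rule and summation over coordinates
  give the identity, with no boundary term.\<close>

lemma divergence_theorem_box_bump:
  fixes a b :: "real^'n"
  assumes P: "\<And>i. Ck_on 1 UNIV (\<lambda>x. P x $ i)"
  shows "(LINT x|lebesgue. P x \<bullet> grad (box_bump a b k) x)
      = - (LINT x|lebesgue. divergence P x * box_bump a b k x)"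
    and "integrable lebesgue (\<lambda>x. divergence P x * box_bump a b k x)"
proof -
  let ?\<phi> = "box_bump a b k"
  have \<phi>: "Ck_on l UNIV ?\<phi>" for l
    using smooth_box_bump unfolding smooth_on_def by blast
  obtain R where R: "cbox a b \<subseteq> cball 0 R"
    using bounded_subset_ballD[OF bounded_cbox] ball_subset_cball by (metis subset_trans)
  then have \<phi>0: "?\<phi> x = 0" and g0: "grad ?\<phi> x = 0" if "x \<notin> cball 0 R" for x
    using that box_subset_cbox[of a b] by (auto intro!: box_bump_eq_0 grad_box_bump_eq_0)
  have diff: "?\<phi> differentiable at x" "(\<lambda>y. P y $ i) differentiable at x" for x i
    using \<phi>[of 1] P by auto
  have cg: "continuous_on UNIV (\<lambda>x. grad ?\<phi> x $ i)" for i
    using \<phi>[of 1] by auto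
  have cgP: "continuous_on UNIV (\<lambda>x. grad (\<lambda>y. P y $ i) x $ i)" for i
    using P by auto
  have i1: "integrable lborel (\<lambda>x. P x $ i * grad ?\<phi> x $ i)" for i
    by (rule integrable_continuous_bounded_support[where R = R])
       (auto intro!: continuous_on_mult cg Ck_on_0D[OF P] simp: g0 simp del: mem_cball)
  have i2: "integrable lborel (\<lambda>x. grad (\<lambda>y. P y $ i) x $ i * ?\<phi> x)" for i
    by (rule integrable_continuous_bounded_support[where R = R])
       (auto intro!: continuous_on_mult cgP continuous_on_box_bump simp: \<phi>0 simp del: mem_cball)
  have "integral\<^sup>L lborel (\<lambda>x. P x $ i * grad ?\<phi> x $ i)
      + integral\<^sup>L lborel (\<lambda>x. grad (\<lambda>y. P y $ i) x $ i * ?\<phi> x) = 0" for i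
    using integral_partial_derivative_eq_0[OF Ck_on_mult[OF P \<phi>], of R i i] i1 i2
    by (simp add: \<phi>0 grad_nth_mult diff)
  then have "(\<Sum>i\<in>UNIV. integral\<^sup>L lborel (\<lambda>x. P x $ i * grad ?\<phi> x $ i))
      = - (\<Sum>i\<in>UNIV. integral\<^sup>L lborel (\<lambda>x. grad (\<lambda>y. P y $ i) x $ i * ?\<phi> x))"
    by (simp add: eq_neg_iff_add_eq_0 flip: sum.distrib)
  then have "(LINT x|lborel. P x \<bullet> grad ?\<phi> x) = - (LINT x|lborel. divergence P x * ?\<phi> x)"
    using i1 i2 by (simp add: inner_vec_def divergence_def sum_distrib_right)
  moreover have int: "integrable lborel (\<lambda>x. P x \<bullet> grad ?\<phi> x)" "integrable lborel (\<lambda>x. divergence P x * ?\<phi> x)"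
    using i1 i2 by (auto simp: inner_vec_def divergence_def sum_distrib_right)
  ultimately show "(LINT x|lebesgue. P x \<bullet> grad ?\<phi> x) = - (LINT x|lebesgue. divergence P x * ?\<phi> x)"
    by (simp add: integral_completion borel_measurable_integrable)
  show "integrable lebesgue (\<lambda>x. divergence P x * ?\<phi> x)"
    using int(2) by (simp add: integrable_completion borel_measurable_integrable)
qed

text \<open>Testing the weak divergence with a bump and integrating by parts shows that
  \<open>d - divergence P\<close> is orthogonal to every bump. Dominated convergence then replaces
  the bumps by the indicator of the box.\<close>

lemma has_weak_div_box_integral:
  fixes u P :: "real^'n \<Rightarrow> real^'n"
  assumes wd: "has_weak_div \<Omega> u d" and \<Omega>: "open \<Omega>" and ab: "cbox a b \<subseteq> \<Omega>"
    and P: "\<And>i. Ck_on 1 UNIV (\<lambda>x. P x $ i)" and eq: "\<And>x. x \<in> cbox a b \<Longrightarrow> u x = P x"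
  shows "set_integrable lebesgue (box a b) (\<lambda>x. d x - divergence P x)"
    and "(LINT x:box a b|lebesgue. d x - divergence P x) = 0"
proof -
  have d: "d \<in> L2 \<Omega>" using wd by (simp add: has_weak_div_def)
  have box\<Omega>: "box a b \<subseteq> \<Omega>" using ab box_subset_cbox by blast
  have int_d: "set_integrable lebesgue (box a b) d"
    by (rule L2_set_integrable[OF d]) (use \<Omega> box\<Omega> in auto)
  have "set_integrable lebesgue (cbox a b) (divergence P)"
    using borel_integrable_compact[OF compact_cbox continuous_on_subset[OF continuous_on_divergence[OF P]]]
    by (auto simp: set_integrable_def integrable_completion borel_measurable_integrable)
  then have int_P: "set_integrable lebesgue (box a b) (divergence P)"
    by (rule set_integrable_subset) (auto simp: box_subset_cbox)
  show int: "set_integrable lebesgue (box a b) (\<lambda>x. d x - divergence P x)"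
    using int_d int_P by (rule set_integral_diff)
  let ?g = "\<lambda>x. indicator (box a b) x * (d x - divergence P x)"
  have g: "integrable lebesgue ?g"
    using int by (simp add: set_integrable_def)
  have zero: "(LINT x|lebesgue. ?g x * box_bump a b k x) = 0" for k
  proof -
    let ?\<phi> = "box_bump a b k"
    have "L2_inner \<Omega> u (grad ?\<phi>) = (LINT x|lebesgue. P x \<bullet> grad ?\<phi> x)"
      unfolding L2_inner_def set_lebesgue_integral_def
    proof (rule Bochner_Integration.integral_cong)
      fix x
      \<comment> \<open>Outside the closed box the gradient of the bump vanishes, so agreement of
        \<open>u\<close> and \<open>P\<close> on that box is enough.\<close>
      show "indicator \<Omega> x *\<^sub>R (u x \<bullet> grad ?\<phi> x) = P x \<bullet> grad ?\<phi> x"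
        using ab eq grad_box_bump_eq_0[of x a b k]
        by (cases "x \<in> cbox a b") auto
    qed simp
    moreover have "L2_inner \<Omega> u (grad ?\<phi>) = - L2_inner \<Omega> d ?\<phi>"
      using wd box_bump_test_function[OF ab] by (simp add: has_weak_div_def)
    moreover have "L2_inner \<Omega> d ?\<phi> = (LINT x|lebesgue. indicator (box a b) x * d x * ?\<phi> x)"
      unfolding L2_inner_def set_lebesgue_integral_def
    proof (rule Bochner_Integration.integral_cong)
      fix x
      show "indicator \<Omega> x *\<^sub>R (d x \<bullet> ?\<phi> x) = indicator (box a b) x * d x * ?\<phi> x"
        using box\<Omega> by (cases "x \<in> box a b") (auto simp: box_bump_eq_0)
    qed simp
    ultimately have *: "(LINT x|lebesgue. indicator (box a b) x * d x * ?\<phi> x)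
        = (LINT x|lebesgue. divergence P x * ?\<phi> x)"
      using divergence_theorem_box_bump(1)[OF P, where a = a and b = b and k = k] by simp
    have int1: "integrable lebesgue (\<lambda>x. indicator (box a b) x * d x * ?\<phi> x)"
    proof (rule Bochner_Integration.integrable_bound)
      show int: "integrable lebesgue (\<lambda>x. indicator (box a b) x * d x)"
        using int_d by (simp add: set_integrable_def)
      show "(\<lambda>x. indicator (box a b) x * d x * ?\<phi> x) \<in> borel_measurable lebesgue"
        by (rule borel_measurable_times[OF borel_measurable_integrable[OF int] borel_measurable_box_bump])
      show "AE x in lebesgue. norm (indicator (box a b) x * d x * ?\<phi> x)
          \<le> norm (indicator (box a b) x * d x)"
        by (simp only: real_norm_def abs_mult_box_bump_le AE_I2)
    qed
    have "?g x * ?\<phi> x = indicator (box a b) x * d x * ?\<phi> x - divergence P x * ?\<phi> x" for x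
      by (cases "x \<in> box a b") (auto simp: box_bump_eq_0 algebra_simps)
    then show ?thesis
      using * int1 divergence_theorem_box_bump(2)[OF P, where a = a and b = b and k = k] by simp
  qed
  have "(\<lambda>k. LINT x|lebesgue. ?g x * box_bump a b k x)
      \<longlonglongrightarrow> (LINT x|lebesgue. ?g x * indicator (box a b) x)"
  proof (rule integral_dominated_convergence)
    show "integrable lebesgue (\<lambda>x. \<bar>?g x\<bar>)"
      using g by (rule integrable_abs)
    show "(\<lambda>x. ?g x * box_bump a b k x) \<in> borel_measurable lebesgue" for k
      by (rule borel_measurable_times[OF borel_measurable_integrable[OF g] borel_measurable_box_bump])
    show "(\<lambda>x. ?g x * indicator (box a b) x) \<in> borel_measurable lebesgue"
      by (rule borel_measurable_times[OF borel_measurable_integrable[OF g] borel_measurable_indicator]) simp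
    show "AE x in lebesgue. (\<lambda>k. ?g x * box_bump a b k x) \<longlonglongrightarrow> ?g x * indicator (box a b) x"
      by (intro AE_I2 tendsto_intros box_bump_tendsto)
    show "AE x in lebesgue. norm (?g x * box_bump a b k x) \<le> \<bar>?g x\<bar>" for k
      by (simp only: real_norm_def abs_mult_box_bump_le AE_I2)
  qed
  then have "(LINT x|lebesgue. ?g x * indicator (box a b) x) = 0"
    by (simp add: zero LIMSEQ_const_iff)
  moreover have "?g x * indicator (box a b) x = indicator (box a b) x *\<^sub>R (d x - divergence P x)" for x
    by (auto simp: indicator_def)
  ultimately show "(LINT x:box a b|lebesgue. d x - divergence P x) = 0"
    by (simp add: set_lebesgue_integral_def)
qed

text \<open>The open set \<open>V\<close> is a countable union of closed boxes. On each of them the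
  difference of the two divergences has vanishing box integrals, and countably many exceptional null
  sets can be united.\<close>

lemma has_weak_div_AE_eq_divergence:
  fixes u P :: "real^'n \<Rightarrow> real^'n"
  assumes wd: "has_weak_div \<Omega> u d" and \<Omega>: "open \<Omega>" and V: "open V" "V \<subseteq> \<Omega>"
    and P: "\<And>i. Ck_on 1 UNIV (\<lambda>x. P x $ i)" and eq: "\<And>x. x \<in> V \<Longrightarrow> u x = P x"
  shows "AE x in lebesgue. x \<in> V \<longrightarrow> d x = divergence P x"
proof -
  obtain \<D> where \<D>: "countable \<D>" "\<D> \<subseteq> Pow V"
    and boxes: "\<And>X. X \<in> \<D> \<Longrightarrow> \<exists>a b. X = cbox a b" and V_eq: "\<Union>\<D> = V"
    using open_countable_Union_open_cbox[OF V(1)] by metis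
  have "AE x in lebesgue. x \<in> X \<longrightarrow> d x = divergence P x" if X: "X \<in> \<D>" for X
  proof -
    obtain a b where ab: "X = cbox a b" using boxes[OF X] by blast
    have sub: "cbox a b \<subseteq> V" using \<D>(2) X ab by blast
    let ?g = "\<lambda>x. indicator (box a b) x *\<^sub>R (d x - divergence P x)"
    have box: "set_integrable lebesgue (box a' b') (\<lambda>x. d x - divergence P x)"
      "(LINT x:box a' b'|lebesgue. d x - divergence P x) = 0" if "cbox a' b' \<subseteq> V" for a' b'
      using has_weak_div_box_integral[OF wd \<Omega> _ P, of a' b'] that V eq by blast+
    have "AE x in lebesgue. ?g x = 0"
    proof (rule AE_eq_0_if_box_integrals_eq_0)
      show "integrable lebesgue ?g" "integral\<^sup>L lebesgue ?g = 0"
        using box[OF sub] by (simp_all add: set_integrable_def set_lebesgue_integral_def)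
      fix a' b'
      \<comment> \<open>Localising to the fixed box turns an arbitrary test box into a smaller box,
        to which the previous integral identity applies.\<close>
      obtain e f where ef: "box a' b' \<inter> box a b = box e f"
        unfolding box_Int_box by blast
      have "(LINT x:box a' b'|lebesgue. ?g x) = (LINT x:box e f|lebesgue. d x - divergence P x)"
        unfolding set_lebesgue_integral_def ef[symmetric]
        by (intro Bochner_Integration.integral_cong) (auto simp: indicator_def)
      also have "\<dots> = 0"
      \<comment> \<open>The empty case is separate because the closed box is the closure of the open
        one only when the latter is nonempty.\<close>
      proof (cases "box e f = {}")
        case False
        then have "cbox e f = closure (box e f)" by (simp add: closure_box)
        also have "\<dots> \<subseteq> cbox a b"
          using ef box_subset_cbox by (intro closure_minimal) auto
        finally show ?thesis using box(2) sub by blast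
      qed (simp add: set_lebesgue_integral_def)
      finally show "(LINT x:box a' b'|lebesgue. ?g x) = 0" .
    qed
    \<comment> \<open>The faces of the box form a null set, which passes from the open box to the
      closed one.\<close>
    moreover have "AE x in lebesgue. x \<notin> cbox a b - box a b"
      using negligible_frontier_interval[of a b]
      by (intro AE_not_in) (simp add: negligible_iff_null_sets)
    ultimately show ?thesis
      unfolding ab by eventually_elim (auto simp: indicator_def)
  qed
  then have "AE x in lebesgue. \<forall>X\<in>\<D>. x \<in> X \<longrightarrow> d x = divergence P x"
    by (subst AE_ball_countable[OF \<D>(1)]) blast
  then show ?thesis
    by eventually_elim (use V_eq in blast)
qed

subsection \<open>The divergence of finite element fields\<close>

lemma poly_space_Ck1:
  assumes "p \<in> poly_space r"
  shows "Ck_on 1 UNIV p"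
proof -
  have "p \<in> poly_space (Suc r)"
    using assms by (rule poly_space_mono) simp
  then have "continuous_on UNIV (\<lambda>x. grad p x $ i)" for i
    by (intro poly_space_continuous poly_space_grad)
  then show ?thesis
    using poly_space_differentiable[OF assms] by simp
qed

text \<open>Coordinatewise, the product rule yields the derivative of \<open>p\<close>, the term
  \<open>q x\<close> and an Euler term in \<open>q\<close>. All three have degree at most
  \<open>s\<close>, although the field itself is only placed in degree \<open>Suc s\<close>.\<close>

lemma RT_piecewise_divergence:
  assumes "u \<in> RT \<Omega> Th s" "K \<in> Th"
  obtains P r where "\<And>i. (\<lambda>x. P x $ i) \<in> poly_space r" "divergence P \<in> poly_space s"
    "\<And>x. x \<in> interior K \<Longrightarrow> u x = P x"
proof -
  obtain p q where p: "\<And>i. (\<lambda>x. p x $ i) \<in> poly_space s" and q: "q \<in> poly_space s"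
    and u: "\<And>x. x \<in> interior K \<Longrightarrow> u x = p x + q x *\<^sub>R x"
    using assms unfolding RT_def vec_poly_space_def by blast
  have p': "(\<lambda>x. p x $ i) \<in> poly_space (Suc s)" for i
    using p by (rule poly_space_mono) simp
  have qx: "(\<lambda>x. q x * x $ i) \<in> poly_space (Suc s)" for i
    using q by (rule poly_space_mult_coordinate)
  have "(\<lambda>x::real^'a. x $ i) differentiable at x" for x i
    by (rule bounded_linear_imp_differentiable[OF bounded_linear_vec_nth])
  then have "grad (\<lambda>x. p x $ i + q x * x $ i) x $ i
      = grad (\<lambda>x. p x $ i) x $ i + (q x + x $ i * grad q x $ i)" for x i
    by (simp add: grad_nth_add grad_nth_mult grad_nth_coordinate poly_space_differentiable[OF p]
        poly_space_differentiable[OF q])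
  then have "divergence (\<lambda>x. p x + q x *\<^sub>R x)
      = (\<lambda>x. \<Sum>i\<in>UNIV. grad (\<lambda>x. p x $ i) x $ i + (q x + x $ i * grad q x $ i))"
    by (simp add: divergence_def fun_eq_iff)
  also have "\<dots> \<in> poly_space s"
    by (intro poly_space_sum poly_space_add q poly_space_coordinate_grad poly_space_grad p')
  finally have div: "divergence (\<lambda>x. p x + q x *\<^sub>R x) \<in> poly_space s" .
  have "(\<lambda>x. (p x + q x *\<^sub>R x) $ i) \<in> poly_space (Suc s)" for i
    using poly_space_add[OF p' qx] by simp
  then show ?thesis
    using div u by (rule that)
qed

lemma BDM_piecewise_divergence:
  assumes "u \<in> BDM \<Omega> Th (Suc s)" "K \<in> Th"
  obtains P r where "\<And>i. (\<lambda>x. P x $ i) \<in> poly_space r" "divergence P \<in> poly_space s"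
    "\<And>x. x \<in> interior K \<Longrightarrow> u x = P x"
proof -
  obtain p where p: "\<And>i. (\<lambda>x. p x $ i) \<in> poly_space (Suc s)"
    and u: "\<And>x. x \<in> interior K \<Longrightarrow> u x = p x"
    using assms unfolding BDM_def vec_poly_space_def by blast
  have "(\<lambda>x. \<Sum>i\<in>UNIV. grad (\<lambda>y. p y $ i) x $ i) \<in> poly_space s"
    by (intro poly_space_sum poly_space_grad p)
  then have "divergence p \<in> poly_space s"
    unfolding divergence_def .
  with p show ?thesis using u by (rule that)
qed

section \<open>Element interiors and piecewise polynomials on the mesh\<close>

lemma triangulates_simplex:
  fixes K :: "(real^'n) set"
  assumes "triangulates Th \<Omega>" "K \<in> Th"
  shows "compact K" "convex K"
proof -
  have "int CARD('n) simplex K"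
    using assms unfolding triangulates_def by blast
  then show "compact K" "convex K"
    by (rule compact_simplex, rule convex_simplex)
qed

text \<open>Two elements meet in a common face, and a face containing an interior point of a convex
  set is the whole set.\<close>

lemma triangulation_interior_unique:
  assumes "triangulation Th" "K \<in> Th" "K' \<in> Th" "x \<in> interior K" "x \<in> interior K'"
  shows "K = K'"
proof -
  have "x \<in> K \<inter> K'" using assms(4,5) interior_subset by blast
  moreover have "(K \<inter> K') face_of K" "(K' \<inter> K) face_of K'"
    using assms(1-3) unfolding triangulation_def by blast+
  ultimately have "K \<inter> K' = K" "K' \<inter> K = K'"
    using face_of_disjoint_interior[of "K \<inter> K'" K] face_of_disjoint_interior[of "K' \<inter> K" K'] assms(4,5)
    by blast+
  then show ?thesis by blast
qed

text \<open>The exceptional points lie on finitely many frontiers of convex sets, which are null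
  sets.\<close>

lemma triangulates_AE_interior:
  assumes "triangulates Th \<Omega>"
  shows "AE x in lebesgue. x \<in> \<Omega> \<longrightarrow> (\<exists>K\<in>Th. x \<in> interior K)"
proof -
  have fin: "finite Th"
    using assms unfolding triangulates_def triangulation_def by blast
  have "negligible (frontier K)" if "K \<in> Th" for K
    by (rule negligible_convex_frontier) (rule triangulates_simplex(2)[OF assms that])
  then have "negligible (\<Union>K\<in>Th. frontier K)"
    using fin by (intro negligible_Union) auto
  then have "AE x in lebesgue. x \<notin> (\<Union>K\<in>Th. frontier K)"
    by (intro AE_not_in) (simp add: negligible_iff_null_sets)
  then show ?thesis
  proof eventually_elim
    case (elim x)
    show ?case
    proof
      assume "x \<in> \<Omega>"
      then obtain K where "K \<in> Th" "x \<in> K"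
        using assms closure_subset unfolding triangulates_def by blast
      then show "\<exists>K\<in>Th. x \<in> interior K"
        using elim closure_subset unfolding frontier_def by blast
    qed
  qed
qed

lemma DG_piecewise:
  fixes D :: "(real^'n) set \<Rightarrow> real^'n \<Rightarrow> real"
  assumes mesh: "triangulates Th \<Omega>" and \<Omega>: "open \<Omega>" "bounded \<Omega>"
    and D: "\<And>K. K \<in> Th \<Longrightarrow> D K \<in> poly_space r"
  obtains q where "q \<in> DG \<Omega> Th r" "\<And>K x. K \<in> Th \<Longrightarrow> x \<in> interior K \<Longrightarrow> q x = D K x"
proof -
  \<comment> \<open>Extension by zero from each interior: inside an element exactly one summand
    survives, and off all interiors the value is 0. Compactness of the elements bounds the sum, and
    boundedness of the domain gives square integrability.\<close>
  define q where "q x = (\<Sum>K\<in>Th. indicator (interior K) x * D K x)" for x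
  have tri: "triangulation Th" and fin: "finite Th"
    using mesh unfolding triangulates_def triangulation_def by blast+
  have q_eq: "q x = D K x" if K: "K \<in> Th" "x \<in> interior K" for K x
  proof -
    have "q x = (\<Sum>K'\<in>Th. if K' = K then D K x else 0)"
      unfolding q_def
      by (rule sum.cong) (use K triangulation_interior_unique[OF tri] in \<open>auto simp: indicator_def\<close>)
    then show ?thesis using fin K by simp
  qed
  have "\<exists>M. \<forall>x\<in>K. \<bar>D K x\<bar> \<le> M" if "K \<in> Th" for K
  proof -
    have "compact (D K ` K)"
      using that by (intro compact_continuous_image poly_space_continuous[OF D] triangulates_simplex[OF mesh])
    then show ?thesis
      by (force dest: compact_imp_bounded simp: bounded_iff)
  qed
  then obtain M where M: "\<And>K x. K \<in> Th \<Longrightarrow> x \<in> K \<Longrightarrow> \<bar>D K x\<bar> \<le> M K"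
    by metis
  have bound: "\<bar>q x\<bar> \<le> (\<Sum>K\<in>Th. \<bar>M K\<bar>)" for x
    unfolding q_def
  proof (rule order_trans[OF sum_abs sum_mono])
    show "\<bar>indicator (interior K) x * D K x\<bar> \<le> \<bar>M K\<bar>" if "K \<in> Th" for K
      using M[OF that, of x] interior_subset[of K] by (auto simp: indicator_def)
  qed
  have "(\<lambda>x. indicator (interior K) x * D K x) \<in> borel_measurable borel" if "K \<in> Th" for K
    by (intro borel_measurable_times borel_measurable_indicator borel_measurable_continuous_onI
        poly_space_continuous[OF D] that) auto
  then have "q \<in> borel_measurable borel"
    unfolding q_def by (rule borel_measurable_sum)
  then have meas: "q \<in> borel_measurable (lebesgue_on \<Omega>)"
    by (intro measurable_restrict_space1 measurable_completion) simp
  interpret finite_measure "lebesgue_on \<Omega>"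
    by (rule finite_measure_lebesgue_on) (use \<Omega> in \<open>simp add: bounded_set_imp_lmeasurable\<close>)
  have "integrable (lebesgue_on \<Omega>) (\<lambda>x. (norm (q x))\<^sup>2)"
  proof (rule integrable_const_bound)
    have "(norm (q x))\<^sup>2 \<le> (\<Sum>K\<in>Th. \<bar>M K\<bar>)\<^sup>2" for x
      unfolding real_norm_def by (rule power_mono[OF bound abs_ge_zero])
    then show "AE x in lebesgue_on \<Omega>. norm ((norm (q x))\<^sup>2) \<le> (\<Sum>K\<in>Th. \<bar>M K\<bar>)\<^sup>2"
      by simp
    show "(\<lambda>x. (norm (q x))\<^sup>2) \<in> borel_measurable (lebesgue_on \<Omega>)"
      using meas by measurable
  qed
  with meas have "q \<in> L2 \<Omega>"
    by (simp add: L2_def)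
  moreover have "\<forall>K\<in>Th. \<exists>p\<in>poly_space r. \<forall>x\<in>interior K. q x = p x"
    using q_eq D by blast
  ultimately have "q \<in> DG \<Omega> Th r"
    by (simp add: DG_def)
  then show ?thesis using q_eq that by blast
qed

text \<open>Membership in \<open>H0div\<close> guarantees that some weak divergence exists, so the
  choice operator in \<open>weak_div\<close> returns one.\<close>

lemma has_weak_div_weak_div:
  assumes "u \<in> RT \<Omega> Th s \<or> u \<in> BDM \<Omega> Th (Suc s)"
  shows "has_weak_div \<Omega> u (weak_div \<Omega> u)"
proof -
  have "u \<in> H0div \<Omega>"
    using assms unfolding RT_def BDM_def by blast
  then have "\<exists>d. has_weak_div \<Omega> u d"
    unfolding H0div_def by blast
  then show ?thesis
    unfolding weak_div_def by (rule someI_ex)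
qed

lemma weak_div_AE_eq_DG:
  assumes mesh: "triangulates Th \<Omega>" and \<Omega>: "open \<Omega>" "bounded \<Omega>"
    and u: "u \<in> RT \<Omega> Th s \<or> u \<in> BDM \<Omega> Th (Suc s)"
  obtains q where "q \<in> DG \<Omega> Th s" "AE x in lebesgue. x \<in> \<Omega> \<longrightarrow> weak_div \<Omega> u x = q x"
proof -
  have "\<forall>K\<in>Th. \<exists>P r. (\<forall>i. (\<lambda>x. P x $ i) \<in> poly_space r) \<and> divergence P \<in> poly_space s \<and>
      (\<forall>x\<in>interior K. u x = P x)"
  proof
    fix K assume K: "K \<in> Th"
    from u show "\<exists>P r. (\<forall>i. (\<lambda>x. P x $ i) \<in> poly_space r) \<and> divergence P \<in> poly_space s \<and>
      (\<forall>x\<in>interior K. u x = P x)"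
    proof
      assume "u \<in> RT \<Omega> Th s"
      then show ?thesis using K by (rule RT_piecewise_divergence) blast
    next
      assume "u \<in> BDM \<Omega> Th (Suc s)"
      then show ?thesis using K by (rule BDM_piecewise_divergence) blast
    qed
  qed
  then obtain P r where P: "\<And>K i. K \<in> Th \<Longrightarrow> (\<lambda>x. P K x $ i) \<in> poly_space (r K)"
    and div: "\<And>K. K \<in> Th \<Longrightarrow> divergence (P K) \<in> poly_space s"
    and eq: "\<And>K x. K \<in> Th \<Longrightarrow> x \<in> interior K \<Longrightarrow> u x = P K x"
    by metis
  obtain q where q: "q \<in> DG \<Omega> Th s"
    and q_eq: "\<And>K x. K \<in> Th \<Longrightarrow> x \<in> interior K \<Longrightarrow> q x = divergence (P K) x"
    using DG_piecewise[OF mesh \<Omega>, of "\<lambda>K. divergence (P K)"] div by blast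
  have wd: "has_weak_div \<Omega> u (weak_div \<Omega> u)"
    using u by (rule has_weak_div_weak_div)
  have "AE x in lebesgue. x \<in> interior K \<inter> \<Omega> \<longrightarrow> weak_div \<Omega> u x = divergence (P K) x" if "K \<in> Th" for K
    using has_weak_div_AE_eq_divergence[OF wd \<Omega>(1), of "interior K \<inter> \<Omega>" "P K"] that \<Omega>(1) eq
      poly_space_Ck1[OF P] by (simp add: open_Int)
  moreover have "finite Th"
    using mesh unfolding triangulates_def triangulation_def by blast
  ultimately have "AE x in lebesgue. \<forall>K\<in>Th. x \<in> interior K \<inter> \<Omega> \<longrightarrow> weak_div \<Omega> u x = divergence (P K) x"
    by (intro AE_finite_allI)
  \<comment> \<open>The finitely many elementwise identities glue together because almost every
    point of the domain lies in some element interior.\<close>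
  with triangulates_AE_interior[OF mesh] have "AE x in lebesgue. x \<in> \<Omega> \<longrightarrow> weak_div \<Omega> u x = q x"
    by eventually_elim (use q_eq in auto)
  with q show ?thesis by (rule that)
qed

lemma weak_div_AE_eq_0:
  assumes mesh: "triangulates Th \<Omega>" and \<Omega>: "open \<Omega>" "bounded \<Omega>"
    and u: "u \<in> RT \<Omega> Th s \<or> u \<in> BDM \<Omega> Th (Suc s)"
    and orth: "\<And>q. q \<in> DG \<Omega> Th s \<Longrightarrow> L2_inner \<Omega> (weak_div \<Omega> u) q = 0"
  shows "AE x in lebesgue_on \<Omega>. weak_div \<Omega> u x = 0"
proof -
  obtain q where q: "q \<in> DG \<Omega> Th s" and "AE x in lebesgue. x \<in> \<Omega> \<longrightarrow> weak_div \<Omega> u x = q x"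
    using weak_div_AE_eq_DG[OF mesh \<Omega> u] by blast
  then have AE: "AE x in lebesgue_on \<Omega>. weak_div \<Omega> u x = q x"
    using \<Omega>(1) by (simp add: AE_restrict_space_iff)
  have meas_q: "q \<in> borel_measurable (lebesgue_on \<Omega>)"
    and int_q: "integrable (lebesgue_on \<Omega>) (\<lambda>x. (q x)\<^sup>2)"
    using q by (simp_all add: DG_def L2_def)
  have meas_div: "weak_div \<Omega> u \<in> borel_measurable (lebesgue_on \<Omega>)"
    using has_weak_div_weak_div[OF u] by (simp add: has_weak_div_def L2_def)
  \<comment> \<open>Only one factor of the square is replaced by \<open>weak_div \<Omega> u\<close>.
    The result is the constraint tested with \<open>q\<close> itself.\<close>
  have "(LINT x|lebesgue_on \<Omega>. (q x)\<^sup>2) = (LINT x|lebesgue_on \<Omega>. weak_div \<Omega> u x * q x)"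
  proof (rule integral_cong_AE)
    show "AE x in lebesgue_on \<Omega>. (q x)\<^sup>2 = weak_div \<Omega> u x * q x"
      using AE by eventually_elim (simp add: power2_eq_square)
  qed (use meas_q meas_div in measurable)
  also have "\<dots> = L2_inner \<Omega> (weak_div \<Omega> u) q"
    using \<Omega>(1) by (simp add: L2_inner_def set_lebesgue_integral_def integral_restrict_space)
  finally have "(LINT x|lebesgue_on \<Omega>. (q x)\<^sup>2) = 0"
    using orth[OF q] by simp
  then have "AE x in lebesgue_on \<Omega>. (q x)\<^sup>2 = 0"
    by (subst (asm) integral_nonneg_eq_0_iff_AE[OF int_q]) simp_all
  with AE show ?thesis
    by eventually_elim simp
qed

theorem proposition2p1:
  fixes \<Omega> :: "(real^'n) set" and Th :: "(real^'n) set set"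
    and \<iota> :: "'n \<Rightarrow> 3" and \<nu> :: "(real^'n) set \<Rightarrow> real^'n"
    and s m :: nat and U :: "(real^'n \<Rightarrow> real^'n) set"
    and \<alpha> \<beta> :: "(real^'n) set \<Rightarrow> (real^'n \<Rightarrow> real^'n) \<Rightarrow> real^'n \<Rightarrow> real"
    and T :: real
    and u :: "real \<Rightarrow> real^'n \<Rightarrow> real^'n" and \<rho> p :: "real \<Rightarrow> real^'n \<Rightarrow> real"
  assumes dim: "CARD('n) = 2 \<or> CARD('n) = 3"
    and numbering: "inj \<iota>" "CARD('n) = 2 \<Longrightarrow> range \<iota> = {1, 2}"
    and domain: "open \<Omega>" "connected \<Omega>" "bounded \<Omega>" "\<Omega> \<noteq> {}"
    and mesh: "triangulates Th \<Omega>"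
    and normals: "\<And>e. e \<in> interior_faces Th \<Omega> \<Longrightarrow> unit_normal e (\<nu> e)"
    and U: "U = RT \<Omega> Th s \<or> U = BDM \<Omega> Th (s + 1)"
    and alpha: "\<And>e w. e \<in> interior_faces Th \<Omega> \<Longrightarrow> w \<in> U \<Longrightarrow>
      (\<forall>x\<in>e. 0 \<le> \<alpha> e w x) \<or>
      (\<exists>c. 0 \<le> c \<and> c \<le> 1/2 \<and>
         (\<forall>x\<in>e. \<alpha> e w x = c * (normal_comp Th e (\<nu> e) w x / \<bar>normal_comp Th e (\<nu> e) w x\<bar>)))"
    and beta_nonneg: "\<And>e w x. e \<in> interior_faces Th \<Omega> \<Longrightarrow> w \<in> U \<Longrightarrow> x \<in> e \<Longrightarrow> 0 \<le> \<beta> e w x"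
    and beta_zero: "\<And>e w x. e \<in> interior_faces Th \<Omega> \<Longrightarrow> w \<in> U \<Longrightarrow> x \<in> e \<Longrightarrow>
      normal_comp Th e (\<nu> e) w x = 0 \<Longrightarrow> \<beta> e w x = 0"
    and spaces: "\<And>t. t \<in> {0<..<T} \<Longrightarrow> u t \<in> U"
      "\<And>t. t \<in> {0<..<T} \<Longrightarrow> \<rho> t \<in> DG \<Omega> Th m"
      "\<And>t. t \<in> {0<..<T} \<Longrightarrow> p t \<in> DG \<Omega> Th s"
    and time_differentiable:
      "\<And>t K x. t \<in> {0<..<T} \<Longrightarrow> K \<in> Th \<Longrightarrow> x \<in> interior K \<Longrightarrow>
         (\<lambda>\<tau>. u \<tau> x) differentiable (at t) \<and>
         (\<lambda>\<tau>. \<rho> \<tau> x) differentiable (at t) \<and>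
         (\<lambda>\<tau>. p \<tau> x) differentiable (at t)"
    and momentum_well_defined:
      "\<And>t e v. t \<in> {0<..<T} \<Longrightarrow> e \<in> interior_faces Th \<Omega> \<Longrightarrow> v \<in> U \<Longrightarrow>
         face_integrable e (\<nu> e)
           (momentum_penalty \<iota> Th \<Omega> (DG \<Omega> Th m) e (\<nu> e) (\<alpha> e (u t)) (\<beta> e (u t)) (u t) (\<rho> t) v)"
    and density_well_defined:
      "\<And>t e \<sigma>. t \<in> {0<..<T} \<Longrightarrow> e \<in> interior_faces Th \<Omega> \<Longrightarrow> \<sigma> \<in> DG \<Omega> Th m \<Longrightarrow>
         face_integrable e (\<nu> e)
           (\<lambda>x. \<beta> e (u t) x * (scalar_jump Th e (\<nu> e) \<sigma> x \<bullet> scalar_jump Th e (\<nu> e) (\<rho> t) x))"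
    and momentum:
      "\<And>t v. t \<in> {0<..<T} \<Longrightarrow> v \<in> U \<Longrightarrow>
         (\<Sum>e\<in>interior_faces Th \<Omega>. face_integral e (\<nu> e)
            (momentum_penalty \<iota> Th \<Omega> (DG \<Omega> Th m) e (\<nu> e) (\<alpha> e (u t)) (\<beta> e (u t)) (u t) (\<rho> t) v))
         + L2_inner \<Omega> (\<lambda>x. vector_derivative (\<lambda>\<tau>. \<rho> \<tau> x *\<^sub>R u \<tau> x) (at t)) v
         + a_form \<iota> Th \<Omega> \<nu> (\<lambda>x. \<rho> t x *\<^sub>R u t x) (u t) v
         - 1/2 * b_form Th \<Omega> \<nu> v (L2_proj \<Omega> (DG \<Omega> Th m) (\<lambda>x. u t x \<bullet> u t x)) (\<rho> t)
         - L2_inner \<Omega> (p t) (weak_div \<Omega> v) = 0"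
    and density:
      "\<And>t \<sigma>. t \<in> {0<..<T} \<Longrightarrow> \<sigma> \<in> DG \<Omega> Th m \<Longrightarrow>
         L2_inner \<Omega> (\<lambda>x. vector_derivative (\<lambda>\<tau>. \<rho> \<tau> x) (at t)) \<sigma>
         - b_form Th \<Omega> \<nu> (u t) \<sigma> (\<rho> t)
         + (\<Sum>e\<in>interior_faces Th \<Omega>. face_integral e (\<nu> e)
              (\<lambda>x. \<beta> e (u t) x * (scalar_jump Th e (\<nu> e) \<sigma> x \<bullet> scalar_jump Th e (\<nu> e) (\<rho> t) x)))
         = 0"
    and incompressibility:
      "\<And>t q. t \<in> {0<..<T} \<Longrightarrow> q \<in> DG \<Omega> Th s \<Longrightarrow> L2_inner \<Omega> (weak_div \<Omega> (u t)) q = 0"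
  shows "\<forall>t\<in>{0<..<T}. AE x in lebesgue_on \<Omega>. weak_div \<Omega> (u t) x = 0"
proof
  fix t assume t: "t \<in> {0<..<T}"
  \<comment> \<open>The constraint is imposed at each time separately, so the argument needs no
    evolution in \<open>t\<close>.\<close>
  have "u t \<in> RT \<Omega> Th s \<or> u t \<in> BDM \<Omega> Th (Suc s)"
    using spaces(1)[OF t] U by auto
  then show "AE x in lebesgue_on \<Omega>. weak_div \<Omega> (u t) x = 0"
    using incompressibility[OF t] by (rule weak_div_AE_eq_0[OF mesh domain(1,3)])
qed

end
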